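(* Let $\mathcal{M}$ and $\mathcal{M}'$ be compact, smooth, $n$-dimensional Riemannian manifolds without boundary, let $\xi\in\mathrm{Isom}(\mathcal{M},\mathcal{M}')$ be an isometry, and let $f\in\mathbf{L}^2(\mathcal{M})$. Let $G:[0,\infty)\to\mathbb{R}$ be nonnegative, decreasing and continuous with $G(0)>0$ and $\lim_{x\to\infty}G(x)=0$. Define $f'=V_\xi f$, where $V_\xi f(x)=f(\xi^{-1}(x))$ for $x\in\mathcal{M}'$. Let $\overline{S}_2^m$ and $(\overline{S}_2^m)'$ be the $m$-layer $2$-nonwindowed geometric scattering transforms on $\mathcal{M}$ and on $\mathcal{M}'$ respectively, produced by the wavelets generated by $G$ on each manifold. Then for every $m\ge1$ $$(\overline{S}_2^m)'f'=\overline{S}_2^mf,$$ i.e. $(\overline{S}_2^m)'[j_1,\dots,j_m]f'=\overline{S}_2^m[j_1,\dots,j_m]f$ for all $(j_1,\dots,j_m)\in\mathbb{Z}^m$.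
   Context: The following is given for $\mathcal{M}$; the same definitions are used on $\mathcal{M}'$. Setting: $\mathcal{M}$ is a compact, smooth, $n$-dimensional Riemannian manifold without boundary contained in $\mathbb{R}^d$, $d\ge n$, with Riemannian volume measure $\mu$ and Laplace-Beltrami operator $\Delta$. $\mathbf{L}^2(\mathcal{M})$ is the space of square-integrable $f:\mathcal{M}\to\mathbb{R}$. The eigenvalues of $-\Delta$ in increasing order are $\{\lambda_k\}_{k\in\mathbb{N}_0}$, with corresponding eigenfunctions $\{e_k\}_{k\in\mathbb{N}_0}$ forming an orthonormal basis of $\mathbf{L}^2(\mathcal{M})$, and $\hat f(k)=\int_{\mathcal{M}}f\,\overline{e_k}\,d\mu$. Wavelets: for $j\in\mathbb{Z}$, $\hat\psi_j(k)=\left[|G(2^{j-1}\lambda_k)|^2-|G(2^j\lambda_k)|^2\right]^{1/2}$, and $f\ast\psi_j=\sum_{k\in\mathbb{N}_0}\hat f(k)\hat\psi_j(k)e_k$. Scattering: $U[j]f=|f\ast\psi_j|$, $U[j_1,\dots,j_m]f=U[j_m]\cdots U[j_1]f$, $\overline{S}_2^m[j_1,\dots,j_m]f=\|U[j_1,\dots,j_m]f\|_{\mathbf{L}^2(\mathcal{M})}$ for $(j_1,\dots,j_m)\in\mathbb{Z}^m$; $\overline{S}_2^mf$ is the family of these numbers. *)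

theory Defs
  imports "HOL-Analysis.Analysis"
begin

section \<open>Smooth maps between Euclidean spaces\<close>

primrec times_differentiable_on ::
  "nat \<Rightarrow> 'a::real_normed_vector set \<Rightarrow> ('a \<Rightarrow> 'b::real_normed_vector) \<Rightarrow> bool" where
  "times_differentiable_on 0 S f \<longleftrightarrow> continuous_on S f"
| "times_differentiable_on (Suc k) S f \<longleftrightarrow>
     (\<forall>x\<in>S. f differentiable (at x)) \<and>
     (\<forall>v. times_differentiable_on k S (\<lambda>x. frechet_derivative f (at x) v))"

text \<open>Used only for open \<open>S\<close>, where it means that \<open>f\<close> is \<open>C\<close>-infinity on \<open>S\<close>.\<close>

definition smooth_on ::
  "'a::real_normed_vector set \<Rightarrow> ('a \<Rightarrow> 'b::real_normed_vector) \<Rightarrow> bool" where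
  "smooth_on S f \<longleftrightarrow> (\<forall>k. times_differentiable_on k S f)"

definition partial_deriv ::
  "'n \<Rightarrow> (real^'n::finite \<Rightarrow> 'b::real_normed_vector) \<Rightarrow> real^'n \<Rightarrow> 'b" where
  "partial_deriv i h x = frechet_derivative h (at x) (axis i 1)"


section \<open>Embedded manifolds without boundary\<close>

text \<open>
  The dimension of a manifold is \<open>CARD('n)\<close>; it is passed as a type argument because the
  charts do not occur in the types of the other arguments. A chart is a smooth parametrization
  by an open subset of \<open>real^'n\<close>: an immersion that is a homeomorphism onto a
  relatively open subset of \<open>M\<close>. Ranging over all charts amounts to using the maximal atlas.
\<close>

definition chart ::
  "'a::euclidean_space set \<Rightarrow> (real^'n::finite) set \<Rightarrow> (real^'n \<Rightarrow> 'a) \<Rightarrow> bool" where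
  "chart M U \<phi> \<longleftrightarrow>
     open U \<and> smooth_on U \<phi> \<and> (\<forall>x\<in>U. inj (frechet_derivative \<phi> (at x))) \<and>
     openin (top_of_set M) (\<phi> ` U) \<and> (\<exists>\<psi>. homeomorphism U (\<phi> ` U) \<phi> \<psi>)"

definition smooth_submanifold :: "'n::finite itself \<Rightarrow> 'a::euclidean_space set \<Rightarrow> bool" where
  "smooth_submanifold N M \<longleftrightarrow>
     (\<forall>p\<in>M. \<exists>(U :: (real^'n) set) \<phi>. chart M U \<phi> \<and> p \<in> \<phi> ` U)"

definition tangent_space ::
  "'n::finite itself \<Rightarrow> 'a::euclidean_space set \<Rightarrow> 'a \<Rightarrow> 'a set" where
  "tangent_space N M p =
     {v. \<exists>(U :: (real^'n) set) \<phi> x w.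
        chart M U \<phi> \<and> x \<in> U \<and> \<phi> x = p \<and> v = frechet_derivative \<phi> (at x) w}"

definition smooth_on_manifold ::
  "'n::finite itself \<Rightarrow> 'a::euclidean_space set \<Rightarrow> ('a \<Rightarrow> 'b::real_normed_vector) \<Rightarrow> bool" where
  "smooth_on_manifold N M f \<longleftrightarrow>
     (\<forall>(U :: (real^'n) set) \<phi>. chart M U \<phi> \<longrightarrow> smooth_on U (f \<circ> \<phi>))"


section \<open>Riemannian metrics, volume and the Laplace--Beltrami operator\<close>

text \<open>
  The metric \<open>g\<close> is arbitrary; the one induced by the ambient space is
  \<open>g p u v = u \<bullet> v\<close>. Only the values \<open>g p u v\<close> with \<open>u\<close> and \<open>v\<close> tangent
  to \<open>M\<close> at \<open>p \<in> M\<close> matter.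
\<close>

definition gram ::
  "('a::euclidean_space \<Rightarrow> 'a \<Rightarrow> 'a \<Rightarrow> real) \<Rightarrow> (real^'n::finite \<Rightarrow> 'a) \<Rightarrow> real^'n \<Rightarrow> real^'n^'n" where
  "gram g \<phi> x = (\<chi> i j. g (\<phi> x) (partial_deriv i \<phi> x) (partial_deriv j \<phi> x))"

definition riemannian_metric ::
  "'n::finite itself \<Rightarrow> 'a::euclidean_space set \<Rightarrow> ('a \<Rightarrow> 'a \<Rightarrow> 'a \<Rightarrow> real) \<Rightarrow> bool" where
  "riemannian_metric N M g \<longleftrightarrow>
     (\<forall>p\<in>M. \<forall>u\<in>tangent_space N M p. \<forall>v\<in>tangent_space N M p.
        g p u v = g p v u \<and>
        (\<forall>w\<in>tangent_space N M p. \<forall>c. g p (c *\<^sub>R u + v) w = c * g p u w + g p v w) \<and>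
        (u \<noteq> 0 \<longrightarrow> g p u u > 0)) \<and>
     (\<forall>(U :: (real^'n) set) \<phi>. chart M U \<phi> \<longrightarrow> (\<forall>i j. smooth_on U (\<lambda>x. gram g \<phi> x $ i $ j)))"

definition closed_riemannian_manifold ::
  "'n::finite itself \<Rightarrow> 'a::euclidean_space set \<Rightarrow> ('a \<Rightarrow> 'a \<Rightarrow> 'a \<Rightarrow> real) \<Rightarrow> bool" where
  "closed_riemannian_manifold N M g \<longleftrightarrow>
     compact M \<and> smooth_submanifold N M \<and> riemannian_metric N M g"

text \<open>The Borel measure on \<open>M\<close> with density \<open>sqrt (det (g\<^sub>i\<^sub>j))\<close> in every chart;
  these requirements determine it uniquely.\<close>

definition riemannian_volume ::
  "'n::finite itself \<Rightarrow> 'a::euclidean_space set \<Rightarrow> ('a \<Rightarrow> 'a \<Rightarrow> 'a \<Rightarrow> real) \<Rightarrow> 'a measure \<Rightarrow> bool" where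
  "riemannian_volume N M g \<mu> \<longleftrightarrow>
     sets \<mu> = sets (restrict_space borel M) \<and>
     (\<forall>(U :: (real^'n) set) \<phi>. chart M U \<phi> \<longrightarrow>
        (\<forall>A\<in>sets \<mu>. A \<subseteq> \<phi> ` U \<longrightarrow>
           emeasure \<mu> A = (\<integral>\<^sup>+x\<in>U \<inter> \<phi> -` A. ennreal (sqrt (det (gram g \<phi> x))) \<partial>lborel)))"

text \<open>The coordinate expression of \<open>\<Delta>\<close> in the chart \<open>\<phi>\<close>,
  for a function whose coordinate representation is \<open>h\<close>.\<close>

definition laplacian_in_chart ::
  "('a::euclidean_space \<Rightarrow> 'a \<Rightarrow> 'a \<Rightarrow> real) \<Rightarrow> (real^'n::finite \<Rightarrow> 'a) \<Rightarrow> (real^'n \<Rightarrow> real) \<Rightarrow>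
     real^'n \<Rightarrow> real" where
  "laplacian_in_chart g \<phi> h x =
     1 / sqrt (det (gram g \<phi> x)) *
     (\<Sum>i\<in>UNIV. partial_deriv i
        (\<lambda>y. sqrt (det (gram g \<phi> y)) *
             (\<Sum>j\<in>UNIV. matrix_inv (gram g \<phi> y) $ i $ j * partial_deriv j h y)) x)"

definition has_laplacian ::
  "'n::finite itself \<Rightarrow> 'a::euclidean_space set \<Rightarrow> ('a \<Rightarrow> 'a \<Rightarrow> 'a \<Rightarrow> real) \<Rightarrow>
     ('a \<Rightarrow> real) \<Rightarrow> ('a \<Rightarrow> real) \<Rightarrow> bool" where
  "has_laplacian N M g u w \<longleftrightarrow>
     smooth_on_manifold N M u \<and>
     (\<forall>(U :: (real^'n) set) \<phi>. chart M U \<phi> \<longrightarrow>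
        (\<forall>x\<in>U. w (\<phi> x) = laplacian_in_chart g \<phi> (u \<circ> \<phi>) x))"

definition riemannian_isometry ::
  "'n::finite itself \<Rightarrow> 'a::euclidean_space set \<Rightarrow> ('a \<Rightarrow> 'a \<Rightarrow> 'a \<Rightarrow> real) \<Rightarrow>
     'b::euclidean_space set \<Rightarrow> ('b \<Rightarrow> 'b \<Rightarrow> 'b \<Rightarrow> real) \<Rightarrow> ('a \<Rightarrow> 'b) \<Rightarrow> bool" where
  "riemannian_isometry N M g M' g' \<xi> \<longleftrightarrow>
     bij_betw \<xi> M M' \<and> smooth_on_manifold N M \<xi> \<and> smooth_on_manifold N M' (inv_into M \<xi>) \<and>
     (\<forall>(U :: (real^'n) set) \<phi>. chart M U \<phi> \<longrightarrow>
        (\<forall>x\<in>U. \<forall>v w.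
           g' (\<xi> (\<phi> x)) (frechet_derivative (\<xi> \<circ> \<phi>) (at x) v) (frechet_derivative (\<xi> \<circ> \<phi>) (at x) w)
           = g (\<phi> x) (frechet_derivative \<phi> (at x) v) (frechet_derivative \<phi> (at x) w)))"

definition transport :: "'a set \<Rightarrow> ('a \<Rightarrow> 'b) \<Rightarrow> ('a \<Rightarrow> real) \<Rightarrow> 'b \<Rightarrow> real" where
  "transport M \<xi> f = (\<lambda>x. f (inv_into M \<xi> x))"


section \<open>Square-integrable functions\<close>

text \<open>Elements of \<open>L2\<close> are represented by functions, not by almost-everywhere classes.\<close>

definition L2 :: "'a measure \<Rightarrow> ('a \<Rightarrow> real) set" where
  "L2 \<mu> = {f \<in> borel_measurable \<mu>. integrable \<mu> (\<lambda>x. (f x)\<^sup>2)}"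

definition L2_inner :: "'a measure \<Rightarrow> ('a \<Rightarrow> real) \<Rightarrow> ('a \<Rightarrow> real) \<Rightarrow> real" where
  "L2_inner \<mu> f h = (\<integral>x. f x * h x \<partial>\<mu>)"

definition L2_norm :: "'a measure \<Rightarrow> ('a \<Rightarrow> real) \<Rightarrow> real" where
  "L2_norm \<mu> f = sqrt (\<integral>x. (f x)\<^sup>2 \<partial>\<mu>)"

definition L2_sums :: "'a measure \<Rightarrow> (nat \<Rightarrow> 'a \<Rightarrow> real) \<Rightarrow> ('a \<Rightarrow> real) \<Rightarrow> bool" where
  "L2_sums \<mu> s h \<longleftrightarrow>
     h \<in> L2 \<mu> \<and> (\<lambda>N. L2_norm \<mu> (\<lambda>x. h x - (\<Sum>k<N. s k x))) \<longlonglongrightarrow> 0"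

definition orthonormal_basis :: "'a measure \<Rightarrow> (nat \<Rightarrow> 'a \<Rightarrow> real) \<Rightarrow> bool" where
  "orthonormal_basis \<mu> e \<longleftrightarrow>
     (\<forall>k. e k \<in> L2 \<mu>) \<and>
     (\<forall>k l. L2_inner \<mu> (e k) (e l) = (if k = l then 1 else 0)) \<and>
     (\<forall>f\<in>L2 \<mu>. L2_sums \<mu> (\<lambda>k x. L2_inner \<mu> f (e k) * e k x) f)"

text \<open>Eigenvalues are repeated according to multiplicity.\<close>

definition laplace_eigenbasis ::
  "'n::finite itself \<Rightarrow> 'a::euclidean_space set \<Rightarrow> ('a \<Rightarrow> 'a \<Rightarrow> 'a \<Rightarrow> real) \<Rightarrow> 'a measure \<Rightarrow>
     (nat \<Rightarrow> real) \<Rightarrow> (nat \<Rightarrow> 'a \<Rightarrow> real) \<Rightarrow> bool" where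
  "laplace_eigenbasis N M g \<mu> lam e \<longleftrightarrow>
     mono lam \<and> (\<forall>k. has_laplacian N M g (e k) (\<lambda>p. - (lam k * e k p))) \<and> orthonormal_basis \<mu> e"


section \<open>Wavelets and the scattering transform\<close>

definition wavelet_coeff :: "(real \<Rightarrow> real) \<Rightarrow> (nat \<Rightarrow> real) \<Rightarrow> int \<Rightarrow> nat \<Rightarrow> real" where
  "wavelet_coeff G lam j k =
     sqrt (\<bar>G (2 powi (j - 1) * lam k)\<bar>\<^sup>2 - \<bar>G (2 powi j * lam k)\<bar>\<^sup>2)"

text \<open>The sum of the series in \<open>L2\<close>, which is unique up to a null set; \<open>SOME\<close> picks
  a representative.\<close>

definition wavelet_conv ::
  "(real \<Rightarrow> real) \<Rightarrow> 'a measure \<Rightarrow> (nat \<Rightarrow> real) \<Rightarrow> (nat \<Rightarrow> 'a \<Rightarrow> real) \<Rightarrow> int \<Rightarrow>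
     ('a \<Rightarrow> real) \<Rightarrow> 'a \<Rightarrow> real" where
  "wavelet_conv G \<mu> lam e j f =
     (SOME h. L2_sums \<mu> (\<lambda>k x. L2_inner \<mu> f (e k) * wavelet_coeff G lam j k * e k x) h)"

text \<open>\<open>fold\<close> applies the propagator of the first scale of the path first.\<close>

definition scattering_propagator ::
  "(real \<Rightarrow> real) \<Rightarrow> 'a measure \<Rightarrow> (nat \<Rightarrow> real) \<Rightarrow> (nat \<Rightarrow> 'a \<Rightarrow> real) \<Rightarrow> int list \<Rightarrow>
     ('a \<Rightarrow> real) \<Rightarrow> 'a \<Rightarrow> real" where
  "scattering_propagator G \<mu> lam e js f =
     fold (\<lambda>j u x. \<bar>wavelet_conv G \<mu> lam e j u x\<bar>) js f"

definition nonwindowed_scattering ::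
  "(real \<Rightarrow> real) \<Rightarrow> 'a measure \<Rightarrow> (nat \<Rightarrow> real) \<Rightarrow> (nat \<Rightarrow> 'a \<Rightarrow> real) \<Rightarrow>
     ('a \<Rightarrow> real) \<Rightarrow> int list \<Rightarrow> real" where
  "nonwindowed_scattering G \<mu> lam e f js = L2_norm \<mu> (scattering_propagator G \<mu> lam e js f)"

end

theory Submission
  imports Defs
begin

text \<open>
  An isometry turns charts of \<open>M\<close> into charts of \<open>M'\<close> with the same Gram matrices; hence it
  preserves the volume, and the pullback of the eigenbasis \<open>e'\<close> is a second eigenbasis of the
  Laplacian of \<open>M\<close>, with eigenvalues \<open>lam'\<close>. By Green's identity eigenfunctions for distinct
  eigenvalues are orthogonal, and eigenvalues are nonnegative. Orthogonality implies that the multiplier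
  series defining the convolution with a wavelet has the same sum in both bases, and nonnegativity
  bounds the multiplier, so that the series converges. Thus every propagator commutes with the isometry
  up to a null set, and the norms agree.
\<close>

section \<open>Square-integrable functions\<close>

text \<open>Two arbitrary choices separate the two sides: eigenfunctions are determined only up to a
  change of orthonormal basis in each eigenspace, so \<open>e'\<close> need not correspond to
  \<open>e\<close>, and \<open>wavelet_conv\<close> picks an arbitrary representative of each sum.
  The first is met by never pairing indices: \<open>lam = lam'\<close> is nowhere established, and
  orthogonality between distinct eigenvalues is all that enters. The second is met by an induction
  along the path in which inputs agree only almost everywhere. Since \<open>SOME\<close> tells
  nothing when no candidate exists, convergence of the series has to be proved, and with it a form
  of completeness of \<open>L2\<close>. The geometric obstacle is that the Laplacian is given only
  by its coordinate expression. Green's identity therefore rests on a divergence theorem: the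
  gradient is made a global field, shown independent of the chart, and localized by a partition of
  unity. One continuous derivative suffices there, so the cut-offs can be built from squares of
  truncated quadratics.\<close>

lemma L2_measurable: "f \<in> L2 \<mu> \<Longrightarrow> f \<in> borel_measurable \<mu>"
  by (simp add: L2_def)

lemma L2_integrable_square: "f \<in> L2 \<mu> \<Longrightarrow> integrable \<mu> (\<lambda>x. (f x)\<^sup>2)"
  by (simp add: L2_def)

lemma L2_integrable_mult:
  assumes "f \<in> L2 \<mu>" "h \<in> L2 \<mu>"
  shows "integrable \<mu> (\<lambda>x. f x * h x)"
proof (rule Bochner_Integration.integrable_bound[of _ "\<lambda>x. (f x)\<^sup>2 + (h x)\<^sup>2"])
  show "integrable \<mu> (\<lambda>x. (f x)\<^sup>2 + (h x)\<^sup>2)"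
    using assms by (simp add: L2_def)
  show "(\<lambda>x. f x * h x) \<in> borel_measurable \<mu>"
    using assms by (auto simp: L2_def)
  have "\<bar>a * b\<bar> \<le> a\<^sup>2 + b\<^sup>2" for a b :: real
  proof -
    have "2 * (\<bar>a\<bar> * \<bar>b\<bar>) \<le> a\<^sup>2 + b\<^sup>2"
      using sum_squares_bound[of "\<bar>a\<bar>" "\<bar>b\<bar>"] by (simp add: mult.assoc)
    moreover have "0 \<le> \<bar>a\<bar> * \<bar>b\<bar>"
      by simp
    ultimately show ?thesis
      unfolding abs_mult by linarith
  qed
  then show "AE x in \<mu>. norm (f x * h x) \<le> norm ((f x)\<^sup>2 + (h x)\<^sup>2)"
    by simp
qed

lemma L2_add:
  assumes "f \<in> L2 \<mu>" "h \<in> L2 \<mu>"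
  shows "(\<lambda>x. f x + h x) \<in> L2 \<mu>"
proof -
  have "integrable \<mu> (\<lambda>x. (f x)\<^sup>2 + (h x)\<^sup>2 + 2 * (f x * h x))"
    using assms L2_integrable_mult[OF assms] by (simp add: L2_def)
  then show ?thesis
    using assms by (auto simp: L2_def power2_sum mult.assoc)
qed

lemma L2_cmult: "f \<in> L2 \<mu> \<Longrightarrow> (\<lambda>x. c * f x) \<in> L2 \<mu>"
  by (auto simp: L2_def power_mult_distrib)

lemma L2_diff:
  assumes "f \<in> L2 \<mu>" "h \<in> L2 \<mu>"
  shows "(\<lambda>x. f x - h x) \<in> L2 \<mu>"
  using L2_add[OF assms(1) L2_cmult[OF assms(2), of "-1"]] by simp

lemma L2_sum: "(\<And>k. k \<in> K \<Longrightarrow> s k \<in> L2 \<mu>) \<Longrightarrow> (\<lambda>x. \<Sum>k\<in>K. s k x) \<in> L2 \<mu>"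
proof (induction K rule: infinite_finite_induct)
  case (insert k K)
  then show ?case
    using L2_add[of "s k" \<mu> "\<lambda>x. \<Sum>k\<in>K. s k x"] by simp
qed (simp_all add: L2_def)

lemma L2_abs: "f \<in> L2 \<mu> \<Longrightarrow> (\<lambda>x. \<bar>f x\<bar>) \<in> L2 \<mu>"
  by (auto simp: L2_def)

lemma L2_inner_commute: "L2_inner \<mu> f h = L2_inner \<mu> h f"
  by (simp add: L2_inner_def mult.commute)

lemma L2_inner_diff_left:
  assumes "f \<in> L2 \<mu>" "h \<in> L2 \<mu>" "w \<in> L2 \<mu>"
  shows "L2_inner \<mu> (\<lambda>x. f x - h x) w = L2_inner \<mu> f w - L2_inner \<mu> h w"
  using L2_integrable_mult[OF assms(1,3)] L2_integrable_mult[OF assms(2,3)]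
  by (simp add: L2_inner_def left_diff_distrib)

lemma L2_inner_cmult_left: "L2_inner \<mu> (\<lambda>x. c * f x) w = c * L2_inner \<mu> f w"
  by (simp add: L2_inner_def mult.assoc)

lemma L2_inner_sum_left:
  assumes "\<And>k. k \<in> K \<Longrightarrow> s k \<in> L2 \<mu>" "w \<in> L2 \<mu>"
  shows "L2_inner \<mu> (\<lambda>x. \<Sum>k\<in>K. s k x) w = (\<Sum>k\<in>K. L2_inner \<mu> (s k) w)"
  using L2_integrable_mult[OF assms(1) assms(2)]
  by (simp add: L2_inner_def sum_distrib_right)

lemma L2_inner_cong_AE:
  assumes "f \<in> borel_measurable \<mu>" "h \<in> borel_measurable \<mu>" "w \<in> borel_measurable \<mu>"
    and "AE x in \<mu>. f x = h x"
  shows "L2_inner \<mu> f w = L2_inner \<mu> h w"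
  unfolding L2_inner_def using assms by (intro integral_cong_AE) auto

lemma L2_norm_cong_AE:
  assumes "f \<in> borel_measurable \<mu>" "h \<in> borel_measurable \<mu>" "AE x in \<mu>. f x = h x"
  shows "L2_norm \<mu> f = L2_norm \<mu> h"
  unfolding L2_norm_def using assms by (intro arg_cong[where f = sqrt] integral_cong_AE) auto

text \<open>Cauchy-Schwarz, because the integral of \<open>(h + t f)^2\<close> is a polynomial of
  degree at most two in \<open>t\<close> without negative values.\<close>

lemma L2_inner_bound:
  assumes f: "f \<in> L2 \<mu>" and h: "h \<in> L2 \<mu>"
  shows "\<bar>L2_inner \<mu> f h\<bar> \<le> L2_norm \<mu> f * L2_norm \<mu> h"
proof -
  define A B C where "A = (\<integral>x. (f x)\<^sup>2 \<partial>\<mu>)" and "B = L2_inner \<mu> f h" and "C = (\<integral>x. (h x)\<^sup>2 \<partial>\<mu>)"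
  have "0 \<le> C + 2 * B * t + A * t\<^sup>2" for t
  proof -
    have "0 \<le> (\<integral>x. (h x + t * f x)\<^sup>2 \<partial>\<mu>)"
      by simp
    also have "\<dots> = (\<integral>x. (h x)\<^sup>2 + 2 * t * (f x * h x) + t\<^sup>2 * (f x)\<^sup>2 \<partial>\<mu>)"
      by (intro Bochner_Integration.integral_cong) (auto simp: power2_eq_square algebra_simps)
    also have "\<dots> = C + 2 * t * B + t\<^sup>2 * A"
      using f h L2_integrable_mult[OF f h] by (simp add: A_def B_def C_def L2_inner_def L2_def)
    finally show ?thesis
      by (simp add: mult.commute mult.left_commute)
  qed
  then have "B\<^sup>2 \<le> A * C"
  proof (cases "A = 0")
    case True
    have "B = 0"
    proof (rule ccontr)
      assume "B \<noteq> 0"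
      \<comment> \<open>With \<open>A = 0\<close> the polynomial is affine in \<open>t\<close>, and
        at this \<open>t\<close> its value is -1.\<close>
      have "0 \<le> C + 2 * B * (- (C + 1) / (2 * B)) + A * (- (C + 1) / (2 * B))\<^sup>2"
        by fact
      then show False
        using \<open>B \<noteq> 0\<close> True by (simp add: divide_simps)
    qed
    then show ?thesis using True by simp
  next
    case False
    then have "A > 0"
      by (simp add: A_def order_less_le)
    \<comment> \<open>The minimum lies at \<open>t = - B / A\<close> and has the value
      \<open>C - B^2 / A\<close>.\<close>
    have "0 \<le> C + 2 * B * (- B / A) + A * (- B / A)\<^sup>2"
      by fact
    then show ?thesis
      using \<open>A > 0\<close> by (simp add: field_simps power2_eq_square)
  qed
  then have "\<bar>B\<bar> \<le> sqrt (A * C)"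
    by (intro real_le_rsqrt) simp
  then show ?thesis
    by (simp add: A_def B_def C_def L2_norm_def real_sqrt_mult)
qed

text \<open>By Cauchy-Schwarz the remainder paired with \<open>w\<close> is at most its norm times
  the norm of \<open>w\<close>.\<close>

lemma L2_sums_inner:
  assumes h: "L2_sums \<mu> s h" and s: "\<And>k. s k \<in> L2 \<mu>" and w: "w \<in> L2 \<mu>"
  shows "(\<lambda>k. L2_inner \<mu> (s k) w) sums L2_inner \<mu> h w"
proof -
  have hL: "h \<in> L2 \<mu>" and lim: "(\<lambda>N. L2_norm \<mu> (\<lambda>x. h x - (\<Sum>k<N. s k x))) \<longlonglongrightarrow> 0"
    using h by (auto simp: L2_sums_def)
  have S: "(\<lambda>x. \<Sum>k<N. s k x) \<in> L2 \<mu>" for N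
    using s by (intro L2_sum)
  have "(\<lambda>N. L2_inner \<mu> h w - (\<Sum>k<N. L2_inner \<mu> (s k) w)) \<longlonglongrightarrow> 0"
  proof (rule Lim_null_comparison)
    show "(\<lambda>N. L2_norm \<mu> (\<lambda>x. h x - (\<Sum>k<N. s k x)) * L2_norm \<mu> w) \<longlonglongrightarrow> 0"
      using tendsto_mult_right[OF lim, of "L2_norm \<mu> w"] by simp
    have "norm (L2_inner \<mu> h w - (\<Sum>k<N. L2_inner \<mu> (s k) w))
        \<le> L2_norm \<mu> (\<lambda>x. h x - (\<Sum>k<N. s k x)) * L2_norm \<mu> w" for N
      using L2_inner_bound[OF L2_diff[OF hL S] w, of N]
      by (simp add: L2_inner_diff_left[OF hL S w] L2_inner_sum_left[OF s w])
    then show "\<forall>\<^sub>F N in sequentially. norm (L2_inner \<mu> h w - (\<Sum>k<N. L2_inner \<mu> (s k) w))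
        \<le> L2_norm \<mu> (\<lambda>x. h x - (\<Sum>k<N. s k x)) * L2_norm \<mu> w"
      by simp
  qed
  then show ?thesis
    unfolding sums_def by (rule Lim_transform2[OF tendsto_const])
qed

text \<open>Both sums have the same inner product with \<open>h1 - h2\<close>, so this difference
  has norm zero. It makes the choice in \<open>wavelet_conv\<close> harmless up to null
  sets.\<close>

lemma L2_sums_unique:
  assumes h1: "L2_sums \<mu> s h1" and h2: "L2_sums \<mu> s h2" and s: "\<And>k. s k \<in> L2 \<mu>"
  shows "AE x in \<mu>. h1 x = h2 x"
proof -
  have L: "h1 \<in> L2 \<mu>" "h2 \<in> L2 \<mu>"
    using h1 h2 by (auto simp: L2_sums_def)
  then have d: "(\<lambda>x. h1 x - h2 x) \<in> L2 \<mu>"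
    by (rule L2_diff)
  have "(\<lambda>k. L2_inner \<mu> (s k) (\<lambda>x. h1 x - h2 x)) sums L2_inner \<mu> h1 (\<lambda>x. h1 x - h2 x)"
    "(\<lambda>k. L2_inner \<mu> (s k) (\<lambda>x. h1 x - h2 x)) sums L2_inner \<mu> h2 (\<lambda>x. h1 x - h2 x)"
    using L2_sums_inner[OF h1 s d] L2_sums_inner[OF h2 s d] by auto
  then have "L2_inner \<mu> h1 (\<lambda>x. h1 x - h2 x) = L2_inner \<mu> h2 (\<lambda>x. h1 x - h2 x)"
    by (rule sums_unique2)
  then have "L2_inner \<mu> (\<lambda>x. h1 x - h2 x) (\<lambda>x. h1 x - h2 x) = 0"
    using L d by (simp add: L2_inner_diff_left)
  then have "(\<integral>x. (h1 x - h2 x)\<^sup>2 \<partial>\<mu>) = 0"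
    by (simp add: L2_inner_def power2_eq_square)
  then have "AE x in \<mu>. (h1 x - h2 x)\<^sup>2 = 0"
    using L2_integrable_square[OF d] by (subst (asm) integral_nonneg_eq_0_iff_AE) auto
  then show ?thesis
    by (rule AE_mp) simp
qed

lemma L2_sums_cong_AE:
  assumes "L2_sums \<mu> s h" "\<And>k. s k \<in> borel_measurable \<mu>" "h' \<in> borel_measurable \<mu>"
    and eq: "AE x in \<mu>. h x = h' x"
  shows "L2_sums \<mu> s h'"
proof -
  have h: "h \<in> L2 \<mu>" and lim: "(\<lambda>N. L2_norm \<mu> (\<lambda>x. h x - (\<Sum>k<N. s k x))) \<longlonglongrightarrow> 0"
    using assms(1) by (auto simp: L2_sums_def)
  have [measurable]: "h \<in> borel_measurable \<mu>" "h' \<in> borel_measurable \<mu>" "\<And>k. s k \<in> borel_measurable \<mu>"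
    using h assms by (auto simp: L2_def)
  have "integrable \<mu> (\<lambda>x. (h' x)\<^sup>2)"
    using eq by (intro integrable_cong_AE_imp[OF L2_integrable_square[OF h]]) auto
  moreover have "L2_norm \<mu> (\<lambda>x. h x - (\<Sum>k<N. s k x)) = L2_norm \<mu> (\<lambda>x. h' x - (\<Sum>k<N. s k x))" for N
    using eq by (intro L2_norm_cong_AE) auto
  ultimately show ?thesis
    using lim by (simp add: L2_sums_def L2_def)
qed

section \<open>Orthonormal series and multipliers\<close>

lemma orthonormal_sum_norm:
  assumes e: "\<And>k. e k \<in> L2 \<mu>" "\<And>k l. L2_inner \<mu> (e k) (e l) = (if k = l then 1 else 0)"
    and "finite K"
  shows "(\<integral>x. (\<Sum>k\<in>K. c k * e k x)\<^sup>2 \<partial>\<mu>) = (\<Sum>k\<in>K. (c k)\<^sup>2)"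
proof -
  have ce: "(\<lambda>x. c k * e k x) \<in> L2 \<mu>" for k
    by (intro L2_cmult e)
  have "(\<integral>x. (\<Sum>k\<in>K. c k * e k x)\<^sup>2 \<partial>\<mu>)
      = L2_inner \<mu> (\<lambda>x. \<Sum>k\<in>K. c k * e k x) (\<lambda>x. \<Sum>k\<in>K. c k * e k x)"
    by (simp add: L2_inner_def power2_eq_square)
  also have "\<dots> = (\<Sum>k\<in>K. c k * L2_inner \<mu> (e k) (\<lambda>x. \<Sum>k\<in>K. c k * e k x))"
    by (simp add: L2_inner_sum_left L2_inner_cmult_left ce L2_sum)
  also have "\<dots> = (\<Sum>k\<in>K. c k * (\<Sum>l\<in>K. c l * L2_inner \<mu> (e l) (e k)))"
    by (subst L2_inner_commute) (simp add: L2_inner_sum_left L2_inner_cmult_left ce e(1))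
  also have "\<dots> = (\<Sum>k\<in>K. (c k)\<^sup>2)"
    using \<open>finite K\<close> by (simp add: e(2) sum.delta power2_eq_square if_distrib cong: if_cong)
  finally show ?thesis .
qed

text \<open>Completeness: along a subsequence the increments \<open>D\<^sub>j\<close> of the partial sums satisfy
  \<open>\<parallel>D\<^sub>j\<parallel>\<^sup>2 \<le> 8\<^sup>-\<^sup>j\<close>, so \<open>\<Sum> (2\<^sup>j D\<^sub>j)\<^sup>2\<close> is integrable and the
  subsequence converges almost everywhere; Fatou's lemma then yields convergence in \<open>L2\<close>.\<close>

lemma orthonormal_series_converges:
  assumes e: "\<And>k. e k \<in> L2 \<mu>" "\<And>k l. L2_inner \<mu> (e k) (e l) = (if k = l then 1 else 0)"
    and c: "summable (\<lambda>k. (c k)\<^sup>2)"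
  shows "\<exists>h. L2_sums \<mu> (\<lambda>k x. c k * e k x) h"
proof -
  define S where "S N x = (\<Sum>k<N. c k * e k x)" for N x
  have SL: "S N \<in> L2 \<mu>" for N
    unfolding S_def by (intro L2_sum L2_cmult e)
  have eM[measurable]: "e k \<in> borel_measurable \<mu>" for k
    using e by (simp add: L2_def)
  have [measurable]: "S N \<in> borel_measurable \<mu>" for N
    using SL by (simp add: L2_def)
  \<comment> \<open>The tail of the coefficients bounds the squared distance from \<open>S N\<close>
    to every later partial sum.\<close>
  define R where "R N = (\<Sum>k. (c (k + N))\<^sup>2)" for N
  have R_lim: "R \<longlonglongrightarrow> 0"
  proof -
    have "(\<lambda>N. (\<Sum>k. (c k)\<^sup>2) - (\<Sum>k<N. (c k)\<^sup>2)) \<longlonglongrightarrow> (\<Sum>k. (c k)\<^sup>2) - (\<Sum>k. (c k)\<^sup>2)"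
      by (intro tendsto_diff tendsto_const summable_LIMSEQ c)
    then show ?thesis
      using suminf_minus_initial_segment[OF c] by (simp add: R_def[abs_def])
  qed
  have S_diff: "(\<integral>x. (S n x - S N x)\<^sup>2 \<partial>\<mu>) \<le> R N" if "N \<le> n" for N n
  proof -
    have "S n x - S N x = (\<Sum>k=N..<n. c k * e k x)" for x
      using sum_diff_nat_ivl[of 0 N n "\<lambda>k. c k * e k x"] that by (simp add: S_def atLeast0LessThan)
    then have "(\<integral>x. (S n x - S N x)\<^sup>2 \<partial>\<mu>) = (\<Sum>k=N..<n. (c k)\<^sup>2)"
      using orthonormal_sum_norm[of e, OF e] by simp
    also have "\<dots> = (\<Sum>k<n-N. (c (k + N))\<^sup>2)"
      using that sum.shift_bounds_nat_ivl[of "\<lambda>k. (c k)\<^sup>2" 0 N "n - N"] by (simp add: atLeast0LessThan)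
    also have "\<dots> \<le> R N"
      unfolding R_def by (intro sum_le_suminf summable_ignore_initial_segment c) simp_all
    finally show ?thesis .
  qed
  have S_diff': "(\<integral>\<^sup>+x. ennreal ((S n x - S N x)\<^sup>2) \<partial>\<mu>) \<le> ennreal (R N)" if "N \<le> n" for N n
    using S_diff[OF that] L2_integrable_square[OF L2_diff[OF SL SL]]
    by (subst nn_integral_eq_integral) (auto intro: ennreal_leI)
  have "\<exists>N. \<forall>n\<ge>N. R n < (1/8)^j" for j
  proof -
    obtain N where "\<And>n. n \<ge> N \<Longrightarrow> \<bar>R n\<bar> < (1/8)^j"
      using LIMSEQ_D[OF R_lim, of "(1/8)^j"] by auto
    then show ?thesis
      using abs_less_iff by blast
  qed
  then obtain N0 where N0: "\<And>j n. n \<ge> N0 j \<Longrightarrow> R n < (1/8)^j"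
    by metis
  \<comment> \<open>Summing \<open>N0\<close> makes the indices monotone while dominating
    \<open>N0 j\<close>; the extra \<open>j\<close> forces them to tend to infinity.\<close>
  define r where "r j = (\<Sum>i\<le>j. N0 i) + j" for j
  have r_mono: "r j \<le> r (Suc j)" and r_ge: "r j \<ge> j" for j
    by (simp_all add: r_def)
  have r_N0: "r j \<ge> N0 j" for j
    using member_le_sum[of j "{..j}" N0] by (simp add: r_def)
  define D where "D j x = S (r (Suc j)) x - S (r j) x" for j x
  have [measurable]: "D j \<in> borel_measurable \<mu>" for j
    unfolding D_def[abs_def] by measurable
  \<comment> \<open>The bound \<open>(1/8)^j\<close> absorbs the weight \<open>4^j\<close> and
    leaves the summable \<open>(1/2)^j\<close>; in return, a finite weighted sum at \<open>x\<close>
    forces \<open>D j x\<close> to decay like \<open>(1/2)^j\<close>.\<close>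
  have D: "(\<integral>\<^sup>+x. ennreal (4^j * (D j x)\<^sup>2) \<partial>\<mu>) \<le> ennreal ((1/2)^j)" for j
  proof -
    have "(\<integral>\<^sup>+x. ennreal (4^j * (D j x)\<^sup>2) \<partial>\<mu>) = ennreal (4^j) * (\<integral>\<^sup>+x. ennreal ((D j x)\<^sup>2) \<partial>\<mu>)"
      by (subst nn_integral_cmult[symmetric]) (auto simp: ennreal_mult)
    also have "\<dots> \<le> ennreal (4^j) * ennreal ((1/8)^j)"
      using S_diff'[OF r_mono, of j] N0[OF r_N0, of j] unfolding D_def
      by (intro mult_left_mono order_trans[OF S_diff'[OF r_mono]] ennreal_leI) auto
    also have "\<dots> = ennreal ((1/2)^j)"
      by (simp add: ennreal_mult[symmetric] power_mult_distrib[symmetric])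
    finally show ?thesis .
  qed
  have "(\<integral>\<^sup>+x. (\<Sum>j. ennreal (4^j * (D j x)\<^sup>2)) \<partial>\<mu>) = (\<Sum>j. \<integral>\<^sup>+x. ennreal (4^j * (D j x)\<^sup>2) \<partial>\<mu>)"
    by (intro nn_integral_suminf) measurable
  also have "\<dots> \<le> (\<Sum>j. ennreal ((1/2)^j))"
    using D by (intro suminf_le) auto
  also have "\<dots> < top"
    by (subst suminf_ennreal2) (auto intro: summable_geometric)
  finally have "AE x in \<mu>. (\<Sum>j. ennreal (4^j * (D j x)\<^sup>2)) \<noteq> \<infinity>"
    by (intro nn_integral_PInf_AE) auto
  then have conv: "AE x in \<mu>. convergent (\<lambda>j. S (r j) x)"
  proof (rule AE_mp, intro AE_I2 impI)
    fix x assume fin: "(\<Sum>j. ennreal (4^j * (D j x)\<^sup>2)) \<noteq> \<infinity>"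
    have summ: "summable (\<lambda>j. 4^j * (D j x)\<^sup>2)"
      using fin by (intro summable_suminf_not_top) auto
    define C where "C = (\<Sum>j. 4^j * (D j x)\<^sup>2)"
    have bound: "\<bar>D j x\<bar> \<le> sqrt C * (1/2)^j" for j
    proof -
      have "4^j * (D j x)\<^sup>2 \<le> C"
        using sum_le_suminf[OF summ, of "{j}"] by (simp add: C_def)
      moreover have "(4::real)^j = (2^j)\<^sup>2"
        by (simp add: power2_eq_square flip: power_mult_distrib)
      ultimately have "2^j * \<bar>D j x\<bar> \<le> sqrt C"
        by (intro real_le_rsqrt) (simp add: power_mult_distrib)
      then show ?thesis
        by (simp add: power_divide pos_le_divide_eq mult.commute)
    qed
    have "summable (\<lambda>j. D j x)"
      by (rule summable_comparison_test'[where N = 0, OF summable_mult[OF summable_geometric[of "1/2::real"]]])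
        (use bound in simp_all)
    then have "convergent (\<lambda>n. (\<Sum>j<n. D j x) + S (r 0) x)"
      by (intro convergent_add convergent_const) (simp add: summable_iff_convergent)
    moreover have "(\<Sum>j<n. D j x) + S (r 0) x = S (r n) x" for n
      using sum_lessThan_telescope[of "\<lambda>j. S (r j) x" n] by (simp add: D_def)
    ultimately show "convergent (\<lambda>j. S (r j) x)"
      by simp
  qed
  \<comment> \<open>On the null set where the subsequence diverges, \<open>lim\<close> is merely
    some value.\<close>
  define h where "h x = lim (\<lambda>j. S (r j) x)" for x
  have [measurable]: "h \<in> borel_measurable \<mu>"
    unfolding h_def[abs_def] by measurable
  have h_lim: "AE x in \<mu>. (\<lambda>j. S (r j) x) \<longlonglongrightarrow> h x"
    using conv by (rule AE_mp) (simp add: h_def convergent_LIMSEQ_iff)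
  have hS: "(\<integral>\<^sup>+x. ennreal ((h x - S N x)\<^sup>2) \<partial>\<mu>) \<le> ennreal (R N)" for N
  proof -
    have "(\<integral>\<^sup>+x. ennreal ((h x - S N x)\<^sup>2) \<partial>\<mu>)
        = (\<integral>\<^sup>+x. liminf (\<lambda>j. ennreal ((S (r j) x - S N x)\<^sup>2)) \<partial>\<mu>)"
    proof (rule nn_integral_cong_AE, use h_lim in \<open>rule AE_mp\<close>, intro AE_I2 impI)
      fix x assume "(\<lambda>j. S (r j) x) \<longlonglongrightarrow> h x"
      then have "(\<lambda>j. ennreal ((S (r j) x - S N x)\<^sup>2)) \<longlonglongrightarrow> ennreal ((h x - S N x)\<^sup>2)"
        by (intro tendsto_intros)
      then show "ennreal ((h x - S N x)\<^sup>2) = liminf (\<lambda>j. ennreal ((S (r j) x - S N x)\<^sup>2))"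
        by (rule lim_imp_Liminf[symmetric, OF trivial_limit_sequentially])
    qed
    also have "\<dots> \<le> liminf (\<lambda>j. \<integral>\<^sup>+x. ennreal ((S (r j) x - S N x)\<^sup>2) \<partial>\<mu>)"
      by (intro nn_integral_liminf) auto
    also have "\<dots> \<le> limsup (\<lambda>j. \<integral>\<^sup>+x. ennreal ((S (r j) x - S N x)\<^sup>2) \<partial>\<mu>)"
      by (intro Liminf_le_Limsup) simp
    \<comment> \<open>The estimate requires \<open>N \<le> r j\<close>, which holds from
      \<open>j = N\<close> on because \<open>j \<le> r j\<close>.\<close>
    also have "\<dots> \<le> ennreal (R N)"
      by (intro Limsup_bounded eventually_sequentiallyI[of N] S_diff' order_trans[OF _ r_ge])
    finally show ?thesis .
  qed
  have hSint: "integrable \<mu> (\<lambda>x. (h x - S N x)\<^sup>2)" for N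
    using le_less_trans[OF hS[of N] ennreal_less_top] by (intro integrableI_bounded) auto
  then have "(\<lambda>x. h x - S N x) \<in> L2 \<mu>" for N
    by (simp add: L2_def)
  \<comment> \<open>The sum \<open>S 0\<close> is empty, so this instance concerns \<open>h\<close>
    itself.\<close>
  from L2_add[OF this[of 0] SL[of 0]] have "h \<in> L2 \<mu>"
    by (simp add: S_def)
  moreover have "(\<lambda>N. L2_norm \<mu> (\<lambda>x. h x - S N x)) \<longlonglongrightarrow> 0"
  proof (rule Lim_null_comparison)
    show "(\<lambda>N. sqrt (R N)) \<longlonglongrightarrow> 0"
      using tendsto_real_sqrt[OF R_lim] by simp
    have "(\<integral>x. (h x - S N x)\<^sup>2 \<partial>\<mu>) \<le> R N" for N
    proof -
      have "0 \<le> R N"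
        using S_diff[of N N] by simp
      then show ?thesis
        using hS[of N] hSint[of N] by (simp add: nn_integral_eq_integral)
    qed
    then show "\<forall>\<^sub>F N in sequentially. norm (L2_norm \<mu> (\<lambda>x. h x - S N x)) \<le> sqrt (R N)"
      by (simp add: L2_norm_def)
  qed
  ultimately show ?thesis
    by (auto simp: L2_sums_def S_def)
qed

text \<open>Pairing the expansion of \<open>f\<close> with \<open>f\<close> turns it into the series
  of squared coefficients.\<close>

lemma orthonormal_basis_square_summable:
  assumes "orthonormal_basis \<mu> e" "f \<in> L2 \<mu>"
  shows "summable (\<lambda>k. (L2_inner \<mu> f (e k))\<^sup>2)"
proof -
  have e: "e k \<in> L2 \<mu>" for k
    using assms by (simp add: orthonormal_basis_def)
  have "L2_sums \<mu> (\<lambda>k x. L2_inner \<mu> f (e k) * e k x) f"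
    using assms by (simp add: orthonormal_basis_def)
  from sums_summable[OF L2_sums_inner[OF this L2_cmult[OF e] assms(2)]]
  show ?thesis
    by (simp add: L2_inner_cmult_left power2_eq_square L2_inner_commute[of \<mu> f])
qed

text \<open>A bounded multiplier keeps the coefficients square-summable. This provides the witness
  for the choice in \<open>wavelet_conv\<close>.\<close>

lemma orthonormal_basis_multiplier_exists:
  assumes e: "orthonormal_basis \<mu> e" and f: "f \<in> L2 \<mu>" and b: "\<And>k. \<bar>b k\<bar> \<le> B"
  shows "\<exists>h. L2_sums \<mu> (\<lambda>k x. L2_inner \<mu> f (e k) * b k * e k x) h"
proof (rule orthonormal_series_converges)
  show "e k \<in> L2 \<mu>" "L2_inner \<mu> (e k) (e l) = (if k = l then 1 else 0)" for k l
    using e by (auto simp: orthonormal_basis_def)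
  have "(b k)\<^sup>2 \<le> B\<^sup>2" for k
    using power_mono[OF b[of k], of 2] by simp
  note bound = this
  show "summable (\<lambda>k. (L2_inner \<mu> f (e k) * b k)\<^sup>2)"
    by (rule summable_comparison_test'[where N = 0,
          OF summable_mult[OF orthonormal_basis_square_summable[OF e f], of "B\<^sup>2"]])
      (use bound in \<open>simp add: power_mult_distrib mult.commute mult_right_mono\<close>)
qed

text \<open>Multiplication by \<open>b\<close> commutes with expanding \<open>f\<close>: only terms with \<open>lam k = lam' l\<close>
  contribute to the coefficient of \<open>h\<close> at \<open>e' l\<close>.\<close>

lemma multiplier_basis_independent:
  assumes e: "orthonormal_basis \<mu> e" and e': "orthonormal_basis \<mu> e'"
    and orth: "\<And>k l. lam k \<noteq> lam' l \<Longrightarrow> L2_inner \<mu> (e k) (e' l) = 0"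
    and f: "f \<in> L2 \<mu>"
    and h: "L2_sums \<mu> (\<lambda>k x. L2_inner \<mu> f (e k) * b (lam k) * e k x) h"
  shows "L2_sums \<mu> (\<lambda>l x. L2_inner \<mu> f (e' l) * b (lam' l) * e' l x) h"
proof -
  have eL: "e k \<in> L2 \<mu>" and eL': "e' k \<in> L2 \<mu>" for k
    using e e' by (auto simp: orthonormal_basis_def)
  have "L2_inner \<mu> h (e' l) = L2_inner \<mu> f (e' l) * b (lam' l)" for l
  proof -
    have "(\<lambda>k. L2_inner \<mu> (\<lambda>x. L2_inner \<mu> f (e k) * b (lam k) * e k x) (e' l)) sums L2_inner \<mu> h (e' l)"
      by (intro L2_sums_inner h L2_cmult eL eL')
    \<comment> \<open>Either both sides vanish or the two multipliers coincide; the resulting factor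
      is free of \<open>k\<close> and leaves the sum.\<close>
    moreover have "L2_inner \<mu> (\<lambda>x. L2_inner \<mu> f (e k) * b (lam k) * e k x) (e' l)
        = b (lam' l) * L2_inner \<mu> (\<lambda>x. L2_inner \<mu> f (e k) * e k x) (e' l)" for k
      using orth[of k l] by (cases "lam k = lam' l") (auto simp: L2_inner_cmult_left)
    moreover have "L2_sums \<mu> (\<lambda>k x. L2_inner \<mu> f (e k) * e k x) f"
      using e f by (simp add: orthonormal_basis_def)
    then have "(\<lambda>k. L2_inner \<mu> (\<lambda>x. L2_inner \<mu> f (e k) * e k x) (e' l)) sums L2_inner \<mu> f (e' l)"
      by (intro L2_sums_inner L2_cmult eL eL')
    then have "(\<lambda>k. b (lam' l) * L2_inner \<mu> (\<lambda>x. L2_inner \<mu> f (e k) * e k x) (e' l))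
        sums (b (lam' l) * L2_inner \<mu> f (e' l))"
      by (rule sums_mult)
    ultimately show ?thesis
      using sums_unique2 by (simp add: mult.commute)
  qed
  moreover have "L2_sums \<mu> (\<lambda>l x. L2_inner \<mu> h (e' l) * e' l x) h"
    using e' h by (simp add: orthonormal_basis_def L2_sums_def)
  ultimately show ?thesis
    by simp
qed


section \<open>Measure isomorphisms and scattering\<close>

text \<open>This is what the scattering transform sees of an isometry, apart from the spectrum. The
  inverse laws are confined to the spaces because \<open>inv_into M \<xi>\<close> is meaningful only
  on the image of \<open>M\<close>.\<close>

locale measure_isomorphism =
  fixes \<mu> :: "'a measure" and \<mu>' :: "'b measure" and T :: "'a \<Rightarrow> 'b" and T' :: "'b \<Rightarrow> 'a"
  assumes T[measurable]: "T \<in> measurable \<mu> \<mu>'" and T'[measurable]: "T' \<in> measurable \<mu>' \<mu>"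
    and T'_T: "\<And>x. x \<in> space \<mu> \<Longrightarrow> T' (T x) = x" and T_T': "\<And>y. y \<in> space \<mu>' \<Longrightarrow> T (T' y) = y"
    and distr_T: "distr \<mu> \<mu>' T = \<mu>'"
begin

lemma integrable_pullback:
  fixes h :: "'b \<Rightarrow> real"
  shows "h \<in> borel_measurable \<mu>' \<Longrightarrow> integrable \<mu> (\<lambda>x. h (T x)) \<longleftrightarrow> integrable \<mu>' h"
  using integrable_distr_eq[OF T, of h] by (simp add: distr_T)

lemma integral_pullback:
  fixes h :: "'b \<Rightarrow> real"
  shows "h \<in> borel_measurable \<mu>' \<Longrightarrow> (\<integral>x. h (T x) \<partial>\<mu>) = (\<integral>y. h y \<partial>\<mu>')"
  using integral_distr[OF T, of h] by (simp add: distr_T)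

lemma L2_pullback: "h \<in> L2 \<mu>' \<Longrightarrow> (\<lambda>x. h (T x)) \<in> L2 \<mu>"
  using integrable_pullback[of "\<lambda>y. (h y)\<^sup>2"] by (auto simp: L2_def)

lemma L2_pushforward:
  assumes "f \<in> L2 \<mu>"
  shows "(\<lambda>y. f (T' y)) \<in> L2 \<mu>'"
proof -
  have [measurable]: "f \<in> borel_measurable \<mu>" and i: "integrable \<mu> (\<lambda>x. (f x)\<^sup>2)"
    using assms by (auto simp: L2_def)
  from i have "integrable \<mu> (\<lambda>x. (f (T' (T x)))\<^sup>2)"
    by (rule Bochner_Integration.integrable_cong[THEN iffD1, rotated -1]) (simp_all add: T'_T)
  then show ?thesis
    using integrable_pullback[of "\<lambda>y. (f (T' y))\<^sup>2"] by (auto simp: L2_def)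
qed

lemma L2_inner_pullback:
  assumes "f \<in> borel_measurable \<mu>'" "h \<in> borel_measurable \<mu>'"
  shows "L2_inner \<mu> (\<lambda>x. f (T x)) (\<lambda>x. h (T x)) = L2_inner \<mu>' f h"
  unfolding L2_inner_def using assms by (intro integral_pullback) simp

lemma L2_norm_pullback: "f \<in> borel_measurable \<mu>' \<Longrightarrow> L2_norm \<mu> (\<lambda>x. f (T x)) = L2_norm \<mu>' f"
  unfolding L2_norm_def by (subst integral_pullback) simp_all

lemma L2_sums_pullback:
  assumes s: "\<And>k. s k \<in> borel_measurable \<mu>'" and h: "L2_sums \<mu>' s h"
  shows "L2_sums \<mu> (\<lambda>k x. s k (T x)) (\<lambda>x. h (T x))"
proof -
  have hL: "h \<in> L2 \<mu>'" and lim: "(\<lambda>N. L2_norm \<mu>' (\<lambda>x. h x - (\<Sum>k<N. s k x))) \<longlonglongrightarrow> 0"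
    using h by (auto simp: L2_sums_def)
  have [measurable]: "h \<in> borel_measurable \<mu>'" "\<And>k. s k \<in> borel_measurable \<mu>'"
    using hL s by (auto simp: L2_def)
  have "L2_norm \<mu> (\<lambda>x. h (T x) - (\<Sum>k<N. s k (T x))) = L2_norm \<mu>' (\<lambda>x. h x - (\<Sum>k<N. s k x))" for N
    by (rule L2_norm_pullback[of "\<lambda>x. h x - (\<Sum>k<N. s k x)"]) measurable
  then show ?thesis
    using lim L2_pullback[OF hL] by (simp add: L2_sums_def)
qed

text \<open>For completeness, \<open>f\<close> is pushed forward by \<open>T'\<close>, expanded in
  \<open>e\<close> and pulled back. The result is \<open>f (T' (T x))\<close>, which equals
  \<open>f x\<close> only on the space of \<open>\<mu>\<close>; hence the congruence at the
  end.\<close>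

lemma orthonormal_basis_pullback:
  assumes e: "orthonormal_basis \<mu>' e"
  shows "orthonormal_basis \<mu> (\<lambda>k x. e k (T x))"
proof -
  have eL: "e k \<in> L2 \<mu>'" for k
    using e by (simp add: orthonormal_basis_def)
  have [measurable]: "e k \<in> borel_measurable \<mu>'" for k
    using eL by (rule L2_measurable)
  have "L2_sums \<mu> (\<lambda>k x. L2_inner \<mu> f (\<lambda>x. e k (T x)) * e k (T x)) f" if f: "f \<in> L2 \<mu>" for f
  proof -
    have [measurable]: "f \<in> borel_measurable \<mu>"
      using f by (rule L2_measurable)
    have "L2_inner \<mu> f (\<lambda>x. e k (T x)) = L2_inner \<mu>' (\<lambda>y. f (T' y)) (e k)" for k
    proof -
      have "L2_inner \<mu> f (\<lambda>x. e k (T x)) = L2_inner \<mu> (\<lambda>x. f (T' (T x))) (\<lambda>x. e k (T x))"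
        unfolding L2_inner_def by (intro Bochner_Integration.integral_cong) (simp_all add: T'_T)
      also have "\<dots> = L2_inner \<mu>' (\<lambda>y. f (T' y)) (e k)"
        by (rule L2_inner_pullback[of "\<lambda>y. f (T' y)"]) measurable
      finally show ?thesis .
    qed
    moreover have "L2_sums \<mu>' (\<lambda>k y. L2_inner \<mu>' (\<lambda>y. f (T' y)) (e k) * e k y) (\<lambda>y. f (T' y))"
      using e L2_pushforward[OF f] by (simp add: orthonormal_basis_def)
    ultimately have "L2_sums \<mu> (\<lambda>k x. L2_inner \<mu> f (\<lambda>x. e k (T x)) * e k (T x)) (\<lambda>x. f (T' (T x)))"
      using L2_sums_pullback[of "\<lambda>k y. L2_inner \<mu>' (\<lambda>y. f (T' y)) (e k) * e k y" "\<lambda>y. f (T' y)"]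
      by simp
    then show ?thesis
      by (rule L2_sums_cong_AE) (auto simp: T'_T)
  qed
  moreover have "L2_inner \<mu> (\<lambda>x. e k (T x)) (\<lambda>x. e l (T x)) = (if k = l then 1 else 0)" for k l
    using e L2_inner_pullback[of "e k" "e l"] by (simp add: orthonormal_basis_def)
  ultimately show ?thesis
    using L2_pullback[OF eL] by (simp add: orthonormal_basis_def)
qed

end

text \<open>A nonnegative eigenvalue places both arguments in the domain where \<open>G\<close> is
  controlled and orders them, so that the radicand lies between 0 and
  \<open>(G 0)^2\<close>.\<close>

lemma wavelet_coeff_bound:
  assumes nonneg: "\<And>x. x \<ge> 0 \<Longrightarrow> G x \<ge> 0" and anti: "antimono_on {0..} G" and "lam k \<ge> 0"
  shows "\<bar>wavelet_coeff G lam j k\<bar> \<le> G 0"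
proof -
  define a b where "a = 2 powi (j - 1) * lam k" and "b = 2 powi j * lam k"
  have "0 \<le> a" "a \<le> b"
    using \<open>lam k \<ge> 0\<close> by (auto simp: a_def b_def power_int_diff mult_right_mono)
  then have "G b \<le> G a" "G a \<le> G 0" "0 \<le> G b"
    using monotone_onD[OF anti, of a b] monotone_onD[OF anti, of 0 a] nonneg by auto
  then have "(G b)\<^sup>2 \<le> (G a)\<^sup>2" "(G a)\<^sup>2 \<le> (G 0)\<^sup>2"
    by (auto intro!: power_mono)
  then have "sqrt ((G a)\<^sup>2 - (G b)\<^sup>2) \<le> G 0" "0 \<le> sqrt ((G a)\<^sup>2 - (G b)\<^sup>2)"
    using nonneg[of 0] by (auto intro!: real_le_lsqrt simp: diff_le_eq add_increasing2)
  then show ?thesis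
    by (simp add: wavelet_coeff_def a_def b_def)
qed

text \<open>Bounded coefficients guarantee that a sum exists, and only then does \<open>SOME\<close>
  deliver one.\<close>

lemma wavelet_conv_sums:
  assumes G: "\<And>x. x \<ge> 0 \<Longrightarrow> G x \<ge> 0" "antimono_on {0..} G"
    and lam: "\<And>k. lam k \<ge> 0" and e: "orthonormal_basis \<mu> e" and f: "f \<in> L2 \<mu>"
  shows "L2_sums \<mu> (\<lambda>k x. L2_inner \<mu> f (e k) * wavelet_coeff G lam j k * e k x) (wavelet_conv G \<mu> lam e j f)"
  unfolding wavelet_conv_def
  by (rule someI_ex[OF orthonormal_basis_multiplier_exists[OF e f wavelet_coeff_bound[OF G lam]]])

section \<open>Transfer of the scattering transform along a measure isomorphism\<close>

context measure_isomorphism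
begin

context
  fixes G :: "real \<Rightarrow> real" and lam lam' :: "nat \<Rightarrow> real" and e e'
  assumes G: "\<And>x. x \<ge> 0 \<Longrightarrow> G x \<ge> 0" "antimono_on {0..} G"
    and lam: "\<And>k. lam k \<ge> 0" and lam': "\<And>k. lam' k \<ge> 0"
    and e: "orthonormal_basis \<mu> e" and e': "orthonormal_basis \<mu>' e'"
    and orth: "\<And>k l. lam k \<noteq> lam' l \<Longrightarrow> L2_inner \<mu> (e k) (\<lambda>x. e' l (T x)) = 0"
begin

text \<open>Both functions are sums of the same series in the pulled-back basis, one by transport
  from \<open>\<mu>'\<close>, the other by independence of the basis. The inputs agree only almost
  everywhere since in deeper layers they are chosen representatives.\<close>

lemma wavelet_conv_pullback:
  assumes f: "f \<in> L2 \<mu>" and f': "f' \<in> L2 \<mu>'" and eq: "AE x in \<mu>. f' (T x) = f x"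
  shows "AE x in \<mu>. wavelet_conv G \<mu>' lam' e' j f' (T x) = wavelet_conv G \<mu> lam e j f x"
proof -
  \<comment> \<open>The coefficient depends on the index only through the eigenvalue, as
    independence of the basis requires.\<close>
  define b where "b t = sqrt (\<bar>G (2 powi (j - 1) * t)\<bar>\<^sup>2 - \<bar>G (2 powi j * t)\<bar>\<^sup>2)" for t
  have coeff: "wavelet_coeff G l j k = b (l k)" for l :: "nat \<Rightarrow> real" and k
    by (simp add: wavelet_coeff_def b_def)
  have e'L: "e' k \<in> L2 \<mu>'" for k
    using e' by (simp add: orthonormal_basis_def)
  have [measurable]: "e' k \<in> borel_measurable \<mu>'" "f \<in> borel_measurable \<mu>" "f' \<in> borel_measurable \<mu>'" for k
    using e'L f f' L2_measurable by auto
  have inner: "L2_inner \<mu>' f' (e' k) = L2_inner \<mu> f (\<lambda>x. e' k (T x))" for k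
  proof -
    have "L2_inner \<mu>' f' (e' k) = L2_inner \<mu> (\<lambda>x. f' (T x)) (\<lambda>x. e' k (T x))"
      by (rule L2_inner_pullback[symmetric]) measurable
    also have "\<dots> = L2_inner \<mu> f (\<lambda>x. e' k (T x))"
      using eq by (intro L2_inner_cong_AE) measurable
    finally show ?thesis .
  qed
  have "L2_sums \<mu>' (\<lambda>k x. L2_inner \<mu>' f' (e' k) * b (lam' k) * e' k x) (wavelet_conv G \<mu>' lam' e' j f')"
    using wavelet_conv_sums[of G lam' \<mu>' e' f' j, OF G lam' e' f'] by (simp add: coeff)
  then have "L2_sums \<mu> (\<lambda>k x. L2_inner \<mu> f (\<lambda>x. e' k (T x)) * b (lam' k) * e' k (T x))
      (\<lambda>x. wavelet_conv G \<mu>' lam' e' j f' (T x))"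
    by (subst (asm) inner)
      (rule L2_sums_pullback[of "\<lambda>k y. L2_inner \<mu> f (\<lambda>x. e' k (T x)) * b (lam' k) * e' k y"]; simp)
  moreover have "L2_sums \<mu> (\<lambda>k x. L2_inner \<mu> f (\<lambda>x. e' k (T x)) * b (lam' k) * e' k (T x))
      (wavelet_conv G \<mu> lam e j f)"
  proof (rule multiplier_basis_independent[where b = b and lam = lam and lam' = lam', OF e orthonormal_basis_pullback[OF e'] _ f])
    show "L2_sums \<mu> (\<lambda>k x. L2_inner \<mu> f (e k) * b (lam k) * e k x) (wavelet_conv G \<mu> lam e j f)"
      using wavelet_conv_sums[of G lam \<mu> e f j, OF G lam e f] by (simp add: coeff)
  qed (rule orth)
  ultimately show ?thesis
    by (rule L2_sums_unique) (intro L2_cmult L2_pullback e'L)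
qed

text \<open>Membership in \<open>L2\<close> belongs to the induction because the next convolution is
  controlled only for such inputs. Both functions are generalized since \<open>fold\<close> applies
  the first scale first.\<close>

lemma scattering_propagator_pullback:
  assumes "f \<in> L2 \<mu>" "f' \<in> L2 \<mu>'" "AE x in \<mu>. f' (T x) = f x"
  shows "scattering_propagator G \<mu> lam e js f \<in> L2 \<mu> \<and>
    scattering_propagator G \<mu>' lam' e' js f' \<in> L2 \<mu>' \<and>
    (AE x in \<mu>. scattering_propagator G \<mu>' lam' e' js f' (T x) = scattering_propagator G \<mu> lam e js f x)"
  using assms
proof (induction js arbitrary: f f')
  case Nil
  then show ?case by (simp add: scattering_propagator_def)
next
  case (Cons j js)
  have "wavelet_conv G \<mu> lam e j f \<in> L2 \<mu>" "wavelet_conv G \<mu>' lam' e' j f' \<in> L2 \<mu>'"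
    using wavelet_conv_sums[of G lam \<mu> e f j, OF G lam e Cons.prems(1)]
      wavelet_conv_sums[of G lam' \<mu>' e' f' j, OF G lam' e' Cons.prems(2)]
    by (auto simp: L2_sums_def)
  moreover have "AE x in \<mu>. \<bar>wavelet_conv G \<mu>' lam' e' j f' (T x)\<bar> = \<bar>wavelet_conv G \<mu> lam e j f x\<bar>"
    using wavelet_conv_pullback[OF Cons.prems, of j] by (rule AE_mp) simp
  ultimately show ?case
    using Cons.IH[of "\<lambda>x. \<bar>wavelet_conv G \<mu> lam e j f x\<bar>" "\<lambda>x. \<bar>wavelet_conv G \<mu>' lam' e' j f' x\<bar>"]
    by (simp add: scattering_propagator_def L2_abs)
qed

lemma nonwindowed_scattering_pushforward:
  assumes f: "f \<in> L2 \<mu>"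
  shows "nonwindowed_scattering G \<mu>' lam' e' (\<lambda>y. f (T' y)) js = nonwindowed_scattering G \<mu> lam e f js"
proof -
  have "scattering_propagator G \<mu> lam e js f \<in> L2 \<mu> \<and>
    scattering_propagator G \<mu>' lam' e' js (\<lambda>y. f (T' y)) \<in> L2 \<mu>' \<and>
    (AE x in \<mu>. scattering_propagator G \<mu>' lam' e' js (\<lambda>y. f (T' y)) (T x) = scattering_propagator G \<mu> lam e js f x)"
    using f by (intro scattering_propagator_pullback L2_pushforward AE_I2) (simp_all add: T'_T)
  then show ?thesis
    unfolding nonwindowed_scattering_def
    by (subst L2_norm_pullback[symmetric]) (auto intro!: L2_norm_cong_AE dest: L2_measurable)
qed

end

end


section \<open>Continuously differentiable functions and matrices\<close>

text \<open>A divergence differentiates the flux components once, and sums, products, determinants,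
  inverses and square roots stay in this class where they are defined and regular.\<close>

abbreviation C1_on :: "'a::real_normed_vector set \<Rightarrow> ('a \<Rightarrow> 'b::real_normed_vector) \<Rightarrow> bool" where
  "C1_on \<equiv> times_differentiable_on (Suc 0)"

lemma C1_onI:
  assumes "\<And>x. x \<in> S \<Longrightarrow> (f has_derivative D x) (at x)" "\<And>v. continuous_on S (\<lambda>x. D x v)"
  shows "C1_on S f"
proof -
  have "frechet_derivative f (at x) v = D x v" if "x \<in> S" for x v
    using frechet_derivative_at[OF assms(1)[OF that]] by simp
  then have "continuous_on S (\<lambda>x. frechet_derivative f (at x) v)" for v
    using assms(2)[of v] by (simp cong: continuous_on_cong)
  then show ?thesis
    using assms(1) by (auto simp: differentiable_def)
qed

lemma C1_on_has_derivative:
  "C1_on S f \<Longrightarrow> x \<in> S \<Longrightarrow> (f has_derivative frechet_derivative f (at x)) (at x)"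
  by (simp add: frechet_derivative_works)

lemma C1_on_continuous_derivative: "C1_on S f \<Longrightarrow> continuous_on S (\<lambda>x. frechet_derivative f (at x) v)"
  by simp

lemma C1_on_continuous: "C1_on S f \<Longrightarrow> continuous_on S f"
  by (auto intro!: continuous_at_imp_continuous_on differentiable_imp_continuous_within)

lemma C1_on_const: "C1_on S (\<lambda>x. c)"
  by (rule C1_onI[where D = "\<lambda>x v. 0"]) auto

lemma C1_on_add: 
  assumes "C1_on S f" "C1_on S h"
  shows "C1_on S (\<lambda>x. f x + h x)"
  by (rule C1_onI[OF has_derivative_add[OF C1_on_has_derivative[OF assms(1)] C1_on_has_derivative[OF assms(2)]]])
    (use assms in \<open>auto intro!: continuous_intros\<close>)

lemma C1_on_mult:
  fixes f h :: "'a::real_normed_vector \<Rightarrow> real"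
  assumes "C1_on S f" "C1_on S h"
  shows "C1_on S (\<lambda>x. f x * h x)"
  by (rule C1_onI[OF has_derivative_mult[OF C1_on_has_derivative[OF assms(1)] C1_on_has_derivative[OF assms(2)]]])
    (use assms[THEN C1_on_continuous] assms in \<open>auto intro!: continuous_intros\<close>)

lemma C1_on_sum:
  fixes f :: "'i \<Rightarrow> 'a::real_normed_vector \<Rightarrow> real"
  shows "(\<And>i. i \<in> I \<Longrightarrow> C1_on S (f i)) \<Longrightarrow> C1_on S (\<lambda>x. \<Sum>i\<in>I. f i x)"
  by (induction I rule: infinite_finite_induct)
    (simp_all add: C1_on_const C1_on_add del: times_differentiable_on.simps)

lemma C1_on_prod:
  fixes f :: "'i \<Rightarrow> 'a::real_normed_vector \<Rightarrow> real"
  shows "(\<And>i. i \<in> I \<Longrightarrow> C1_on S (f i)) \<Longrightarrow> C1_on S (\<lambda>x. \<Prod>i\<in>I. f i x)"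
  by (induction I rule: infinite_finite_induct)
    (simp_all add: C1_on_const C1_on_mult del: times_differentiable_on.simps)

lemma C1_on_real_compose:
  fixes f :: "'a::real_normed_vector \<Rightarrow> real"
  assumes f: "C1_on S f" and q: "\<And>x. x \<in> S \<Longrightarrow> (q has_real_derivative q' (f x)) (at (f x))"
    and q': "continuous_on (f ` S) q'"
  shows "C1_on S (\<lambda>x. q (f x))"
proof (rule C1_onI)
  show "((\<lambda>x. q (f x)) has_derivative (\<lambda>v. q' (f x) * frechet_derivative f (at x) v)) (at x)"
    if "x \<in> S" for x
    using has_derivative_compose[OF C1_on_has_derivative[OF f that] q[OF that, unfolded has_field_derivative_def]]
    by (simp add: mult.commute)
  show "continuous_on S (\<lambda>x. q' (f x) * frechet_derivative f (at x) v)" for v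
    using f by (intro continuous_on_mult continuous_on_compose2[OF q' C1_on_continuous[OF f]]) auto
qed

lemma C1_on_cong:
  assumes "open S" "\<And>x. x \<in> S \<Longrightarrow> f x = h x" "C1_on S f"
  shows "C1_on S h"
  by (rule C1_onI[where D = "\<lambda>x. frechet_derivative f (at x)"])
    (use assms in \<open>auto intro!: has_derivative_transform_within_open[OF C1_on_has_derivative[OF assms(3)] assms(1)]\<close>)

lemma C1_on_sqrt:
  assumes "C1_on S f" "\<And>x. x \<in> S \<Longrightarrow> f x > 0"
  shows "C1_on S (\<lambda>x. sqrt (f x))"
  by (rule C1_on_real_compose[OF assms(1), where q' = "\<lambda>t. inverse (sqrt t) / 2"])
    (use assms(2) in \<open>force intro!: DERIV_real_sqrt continuous_intros\<close>)+

lemma C1_on_inverse: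
  fixes f :: "'a::real_normed_vector \<Rightarrow> real"
  assumes "C1_on S f" "\<And>x. x \<in> S \<Longrightarrow> f x \<noteq> 0"
  shows "C1_on S (\<lambda>x. inverse (f x))"
  by (rule C1_on_real_compose[OF assms(1), where q' = "\<lambda>t. - (inverse t ^ Suc (Suc 0))"])
    (use assms(2) in \<open>force intro!: DERIV_inverse continuous_intros\<close>)+

lemma C1_on_det:
  fixes A :: "'a::real_normed_vector \<Rightarrow> real^'n^'n"
  assumes "\<And>i j. C1_on S (\<lambda>x. A x $ i $ j)"
  shows "C1_on S (\<lambda>x. det (A x))"
  unfolding det_def by (intro C1_on_sum C1_on_mult C1_on_prod C1_on_const assms)

section \<open>Inverses and positive definite matrices\<close>

lemma matrix_inv_right: "invertible A \<Longrightarrow> A ** matrix_inv A = mat 1"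
  for A :: "real^'n^'n"
  unfolding invertible_def matrix_inv_def by (metis (mono_tags, lifting) someI_ex)

text \<open>Column \<open>j\<close> of the inverse solves the linear system with right-hand side
  \<open>axis j 1\<close>, so Cramer's rule applies. The entries become quotients of polynomials in
  those of \<open>A\<close>, which carries regularity over to the inverse.\<close>

lemma matrix_inv_cramer:
  fixes A :: "real^'n^'n"
  assumes "det A \<noteq> 0"
  shows "matrix_inv A $ i $ j = det (\<chi> a b. if b = i then axis j 1 $ a else A $ a $ b) * inverse (det A)"
proof -
  have "A ** matrix_inv A = mat 1"
    using assms by (simp add: invertible_det_nz matrix_inv_right)
  then have "A *v (matrix_inv A *v axis j 1) = axis j 1"
    by (simp add: matrix_vector_mul_assoc)
  then have "matrix_inv A *v axis j 1 = (\<chi> k. det (\<chi> a b. if b = k then axis j 1 $ a else A $ a $ b) / det A)"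
    using cramer[OF assms] by blast
  then show ?thesis
    by (simp add: vec_eq_iff matrix_vector_mult_basis column_def divide_inverse)
qed

lemma C1_on_matrix_inv:
  fixes A :: "'a::real_normed_vector \<Rightarrow> real^'n^'n"
  assumes "open S" and A: "\<And>i j. C1_on S (\<lambda>x. A x $ i $ j)" and det: "\<And>x. x \<in> S \<Longrightarrow> det (A x) \<noteq> 0"
  shows "C1_on S (\<lambda>x. matrix_inv (A x) $ i $ j)"
proof (rule C1_on_cong[OF assms(1)])
  show "det (\<chi> a b. if b = i then axis j 1 $ a else A x $ a $ b) * inverse (det (A x)) = matrix_inv (A x) $ i $ j"
    if "x \<in> S" for x
    using matrix_inv_cramer[OF det[OF that]] by simp
  have "C1_on S (\<lambda>x. (\<chi> a b. if b = i then axis j 1 $ a else A x $ a $ b) $ k $ l)" for k l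
    using A by (cases "l = i") (simp_all add: C1_on_const del: times_differentiable_on.simps)
  then show "C1_on S (\<lambda>x. det (\<chi> a b. if b = i then axis j 1 $ a else A x $ a $ b) * inverse (det (A x)))"
    by (intro C1_on_mult C1_on_inverse C1_on_det A det)
qed

lemma smooth_on_imp_C1_on: "smooth_on S f \<Longrightarrow> C1_on S f"
  unfolding smooth_on_def by blast

lemma smooth_on_derivative: "smooth_on S f \<Longrightarrow> smooth_on S (\<lambda>x. frechet_derivative f (at x) v)"
  unfolding smooth_on_def by (metis times_differentiable_on.simps(2))

text \<open>The choice behind \<open>frechet_derivative\<close> depends on \<open>f\<close> only
  through the predicate \<open>has_derivative\<close>, and that predicate sees only the germ at
  \<open>x\<close>.\<close>

lemma partial_deriv_cong:
  assumes "open S" "x \<in> S" "\<And>y. y \<in> S \<Longrightarrow> f y = h y"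
  shows "partial_deriv i f x = partial_deriv i h x"
proof -
  have "(f has_derivative D) (at x) \<longleftrightarrow> (h has_derivative D) (at x)" for D
    using assms has_derivative_transform_within_open by metis
  then show ?thesis
    by (simp add: partial_deriv_def frechet_derivative_def)
qed

lemma frechet_derivative_partial_deriv:
  fixes f :: "real^'n \<Rightarrow> 'b::real_normed_vector"
  assumes "f differentiable at x"
  shows "frechet_derivative f (at x) v = (\<Sum>i\<in>UNIV. v $ i *\<^sub>R partial_deriv i f x)"
proof -
  have "frechet_derivative f (at x) (\<Sum>i\<in>UNIV. v $ i *s axis i 1)
      = (\<Sum>i\<in>UNIV. v $ i *\<^sub>R partial_deriv i f x)"
    using linear_frechet_derivative[OF assms]
    by (simp add: linear_sum linear_scale partial_deriv_def scalar_mult_eq_scaleR)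
  then show ?thesis
    by (simp add: basis_expansion)
qed

lemma pos_def_invertible:
  fixes A :: "real^'n^'n"
  assumes "\<And>v. v \<noteq> 0 \<Longrightarrow> v \<bullet> (A *v v) > 0"
  shows "invertible A"
proof -
  have "v = 0" if "A *v v = 0" for v
    using assms[of v] that by fastforce
  then show ?thesis
    by (metis invertible_left_inverse matrix_left_invertible_ker)
qed

text \<open>The determinant does not vanish on the segment from the identity matrix to \<open>A\<close>.\<close>

lemma pos_def_det_pos:
  fixes A :: "real^'n^'n"
  assumes A: "\<And>v. v \<noteq> 0 \<Longrightarrow> v \<bullet> (A *v v) > 0"
  shows "det A > 0"
proof (rule ccontr)
  assume "\<not> det A > 0"
  \<comment> \<open>A convex combination of positive definite matrices is positive definite, hence
    invertible, while the intermediate value theorem would produce a singular one.\<close>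
  define P where "P t = (1 - t) *\<^sub>R mat 1 + t *\<^sub>R A" for t
  have "continuous_on {0..1} (\<lambda>t. det (P t))"
    unfolding det_def P_def by (intro continuous_intros)
  moreover have "det (P 0) = 1" "det (P 1) = det A"
    by (simp_all add: P_def)
  ultimately obtain t where t: "0 \<le> t" "t \<le> 1" "det (P t) = 0"
    using IVT2'[of "\<lambda>t. det (P t)" 1 0 0] \<open>\<not> det A > 0\<close> by auto
  have "v \<bullet> (P t *v v) > 0" if "v \<noteq> 0" for v
  proof -
    have "P t *v v = (1 - t) *\<^sub>R v + t *\<^sub>R (A *v v)"
      by (simp add: P_def matrix_vector_mult_add_rdistrib scaleR_matrix_vector_assoc[symmetric])
    then have "v \<bullet> (P t *v v) = (1 - t) * (v \<bullet> v) + t * (v \<bullet> (A *v v))"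
      by (simp add: inner_add_right)
    also have "\<dots> > 0"
      using t A[OF that] that by (cases "t = 1") (auto intro!: add_pos_nonneg)
    finally show ?thesis .
  qed
  then show False
    using pos_def_invertible t(3) by (auto simp: invertible_det_nz)
qed

text \<open>Apply a left inverse of the injective derivative of \<open>\<theta>\<close> to \<open>\<theta> \<circ> \<tau>\<close>.\<close>

lemma differentiable_of_immersion_compose:
  fixes \<theta> :: "'c::euclidean_space \<Rightarrow> 'b::euclidean_space" and \<tau> :: "'a::real_normed_vector \<Rightarrow> 'c"
  assumes \<theta>: "(\<theta> has_derivative A) (at (\<tau> x))" and "inj A" and \<tau>: "isCont \<tau> x"
    and comp: "((\<lambda>y. \<theta> (\<tau> y)) has_derivative B) (at x)"
  shows "\<tau> differentiable at x"
proof -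
  have "linear A"
    using \<theta> has_derivative_linear by blast
  then obtain L where "linear L" and L: "L \<circ> A = id"
    using linear_injective_left_inverse[OF _ \<open>inj A\<close>] by blast
  then have bL: "bounded_linear L"
    by (simp add: linear_conv_bounded_linear)
  \<comment> \<open>The left inverse reduces the claim to a map whose derivative at
    \<open>\<tau> x\<close> is the identity.\<close>
  define F where "F z = L (\<theta> z)" for z
  have F: "(F has_derivative (\<lambda>v. v)) (at (\<tau> x))"
    using bounded_linear.has_derivative[OF bL \<theta>] L by (simp add: F_def[abs_def] fun_eq_iff)
  define D where "D v = L (B v)" for v
  have D: "((\<lambda>y. F (\<tau> y)) has_derivative D) (at x)"
    using bounded_linear.has_derivative[OF bL comp] by (simp add: F_def D_def[abs_def])
  then have "bounded_linear D"
    by (rule has_derivative_bounded_linear)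
  then obtain K where K: "K > 0" "\<And>v. norm (D v) \<le> norm v * K"
    using bounded_linear.pos_bounded by blast
  have "(\<tau> has_derivative D) (at x)"
    unfolding has_derivative_at_alt
  proof (intro conjI allI impI)
    show "bounded_linear D" by fact
  next
    fix \<epsilon> :: real assume "\<epsilon> > 0"
    \<comment> \<open>The bound \<open>1/2\<close> lets the term with \<open>norm t\<close> be
      absorbed on the left when it is estimated by \<open>norm (y - x)\<close>; the other bound pays
      for the constant \<open>1 + 2 * (K + 1)\<close> at the end.\<close>
    define \<eta> where "\<eta> = min (1/2) (\<epsilon> / (1 + 2 * (K + 1)))"
    have "\<eta> > 0"
      using \<open>\<epsilon> > 0\<close> \<open>K > 0\<close> by (simp add: \<eta>_def)
    have \<eta>_half: "\<eta> \<le> 1/2"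
      unfolding \<eta>_def by (rule min.cobounded1)
    have "\<eta> \<le> \<epsilon> / (1 + 2 * (K + 1))"
      unfolding \<eta>_def by (rule min.cobounded2)
    then have \<eta>K: "\<eta> * (1 + 2 * (K + 1)) \<le> \<epsilon>"
      using \<open>K > 0\<close> by (simp add: pos_le_divide_eq)
    obtain d1 where d1: "d1 > 0" "\<And>z. norm (z - \<tau> x) < d1 \<Longrightarrow> norm (F z - F (\<tau> x) - (z - \<tau> x)) \<le> \<eta> * norm (z - \<tau> x)"
      using F \<open>\<eta> > 0\<close> unfolding has_derivative_at_alt by blast
    obtain d2 where d2: "d2 > 0" "\<And>y. norm (y - x) < d2 \<Longrightarrow> norm (F (\<tau> y) - F (\<tau> x) - D (y - x)) \<le> \<eta> * norm (y - x)"
      using D \<open>\<eta> > 0\<close> unfolding has_derivative_at_alt by blast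
    obtain d3 where d3: "d3 > 0" "\<And>y. norm (y - x) < d3 \<Longrightarrow> norm (\<tau> y - \<tau> x) < d1"
      using \<tau> \<open>d1 > 0\<close> unfolding continuous_at_eps_delta dist_norm by blast
    show "\<exists>d>0. \<forall>y. norm (y - x) < d \<longrightarrow> norm (\<tau> y - \<tau> x - D (y - x)) \<le> \<epsilon> * norm (y - x)"
    proof (intro exI[of _ "min d2 d3"] conjI allI impI)
      show "min d2 d3 > 0"
        using d2 d3 by simp
      fix y assume y: "norm (y - x) < min d2 d3"
      define t w r s where "t = \<tau> y - \<tau> x" and "w = D (y - x)"
        and "r = F (\<tau> y) - F (\<tau> x) - (\<tau> y - \<tau> x)" and "s = F (\<tau> y) - F (\<tau> x) - D (y - x)"
      have r: "norm r \<le> \<eta> * norm t" and s: "norm s \<le> \<eta> * norm (y - x)" and w: "norm w \<le> norm (y - x) * K"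
        using d1(2)[of "\<tau> y"] d2(2)[of y] d3(2)[of y] y K(2) by (auto simp: t_def w_def r_def s_def)
      have tw: "t - w = s - r" and "t = w + s - r"
        by (simp_all add: t_def w_def r_def s_def)
      then have "norm t \<le> norm w + norm s + norm r"
        using norm_triangle_ineq4[of "w + s" r] norm_triangle_ineq[of w s] by simp
      also have "\<dots> \<le> norm (y - x) * K + 1 * norm (y - x) + (1/2) * norm t"
        using r s w \<eta>_half by (intro add_mono order_trans[OF r] order_trans[OF s] mult_right_mono) auto
      finally have t: "norm t \<le> 2 * (K + 1) * norm (y - x)"
        by (simp add: algebra_simps)
      have "norm (t - w) \<le> norm s + norm r"
        unfolding tw by (rule norm_triangle_ineq4)
      also have "\<dots> \<le> \<eta> * norm (y - x) + \<eta> * (2 * (K + 1) * norm (y - x))"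
        using r s t \<open>\<eta> > 0\<close> by (intro add_mono order_trans[OF r] mult_left_mono) auto
      also have "\<dots> = \<eta> * (1 + 2 * (K + 1)) * norm (y - x)"
        by (simp add: algebra_simps)
      also have "\<dots> \<le> \<epsilon> * norm (y - x)"
        using \<eta>K by (rule mult_right_mono) simp
      finally show "norm (\<tau> y - \<tau> x - D (y - x)) \<le> \<epsilon> * norm (y - x)"
        by (simp add: t_def w_def)
    qed
  qed
  then show ?thesis
    by (auto simp: differentiable_def)
qed


section \<open>Charts, gradients and the volume\<close>

context
  fixes M :: "'a::euclidean_space set" and U :: "(real^'n::finite) set" and \<phi>
  assumes chart: "chart M U \<phi>"
begin

lemma chart_open: "open U"
  using chart by (simp add: chart_def)

lemma chart_smooth: "smooth_on U \<phi>"
  using chart by (simp add: chart_def)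

lemma chart_continuous: "continuous_on U \<phi>"
  by (rule C1_on_continuous[OF smooth_on_imp_C1_on[OF chart_smooth]])

lemma chart_differentiable: "x \<in> U \<Longrightarrow> \<phi> differentiable at x"
  using smooth_on_imp_C1_on[OF chart_smooth] by simp

lemma chart_has_derivative: "x \<in> U \<Longrightarrow> (\<phi> has_derivative frechet_derivative \<phi> (at x)) (at x)"
  using chart_differentiable by (simp add: frechet_derivative_works)

lemma chart_linear_derivative: "x \<in> U \<Longrightarrow> linear (frechet_derivative \<phi> (at x))"
  by (rule linear_frechet_derivative[OF chart_differentiable])

lemma chart_inj_derivative: "x \<in> U \<Longrightarrow> inj (frechet_derivative \<phi> (at x))"
  using chart by (simp add: chart_def)

lemma chart_openin: "openin (top_of_set M) (\<phi> ` U)"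
  using chart by (simp add: chart_def)

lemma chart_image_subset: "\<phi> ` U \<subseteq> M"
  by (rule openin_imp_subset[OF chart_openin])

lemma chart_mem: "x \<in> U \<Longrightarrow> \<phi> x \<in> M"
  using chart_image_subset by blast

lemma chart_homeomorphism: obtains \<psi> where "homeomorphism U (\<phi> ` U) \<phi> \<psi>"
  using chart by (auto simp: chart_def)

lemma chart_tangent: "x \<in> U \<Longrightarrow> frechet_derivative \<phi> (at x) v \<in> tangent_space TYPE('n) M (\<phi> x)"
  using chart unfolding tangent_space_def by blast

end

text \<open>The transition is \<open>\<psi> \<circ> \<phi>\<close> with \<open>\<psi>\<close>
  inverse to \<open>\<theta>\<close>. The definition of a chart makes \<open>\<psi>\<close> only
  continuous; differentiability comes from \<open>\<theta> \<circ> \<tau> = \<phi>\<close> near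
  \<open>x\<close> and the injective derivative of \<open>\<theta>\<close>.\<close>

lemma chart_transition:
  fixes M :: "'a::euclidean_space set" and U V :: "(real^'n::finite) set"
  assumes \<phi>: "chart M U \<phi>" and \<theta>: "chart M V \<theta>" and x: "x \<in> U" and y: "y \<in> V" and eq: "\<phi> x = \<theta> y"
  obtains \<tau> W where "open W" "x \<in> W" "\<And>z. z \<in> W \<Longrightarrow> \<theta> (\<tau> z) = \<phi> z" "\<tau> x = y" "\<tau> differentiable at x"
proof -
  obtain \<psi> where \<psi>: "homeomorphism V (\<theta> ` V) \<theta> \<psi>"
    using chart_homeomorphism[OF \<theta>] by blast
  obtain T where T: "open T" "\<theta> ` V = M \<inter> T"
    using chart_openin[OF \<theta>] by (auto simp: openin_open)
  define W where "W = U \<inter> \<phi> -` T"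
  define \<tau> where "\<tau> z = \<psi> (\<phi> z)" for z
  have W: "open W"
    unfolding W_def using chart_continuous[OF \<phi>] chart_open[OF \<phi>] T by (intro continuous_open_preimage)
  have "\<theta> y \<in> T"
    using T(2) y by blast
  then have "x \<in> W"
    using x eq by (simp add: W_def)
  have W_img: "\<phi> z \<in> \<theta> ` V" if "z \<in> W" for z
    using that chart_mem[OF \<phi>] T(2) by (auto simp: W_def)
  then have \<theta>\<tau>: "\<theta> (\<tau> z) = \<phi> z" if "z \<in> W" for z
    using homeomorphism_apply2[OF \<psi>] that by (simp add: \<tau>_def)
  have \<tau>x: "\<tau> x = y"
    using homeomorphism_apply1[OF \<psi> y] eq by (simp add: \<tau>_def)
  have "continuous_on W \<tau>"
    unfolding \<tau>_def
    by (rule continuous_on_compose2[OF homeomorphism_cont2[OF \<psi>]])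
      (use W_img in \<open>auto intro: continuous_on_subset[OF chart_continuous[OF \<phi>]] simp: W_def\<close>)
  then have "isCont \<tau> x"
    using W \<open>x \<in> W\<close> continuous_on_eq_continuous_at by blast
  moreover have "((\<lambda>z. \<theta> (\<tau> z)) has_derivative frechet_derivative \<phi> (at x)) (at x)"
    using chart_has_derivative[OF \<phi> x] W \<open>x \<in> W\<close>
    by (rule has_derivative_transform_within_open) (simp add: \<theta>\<tau>)
  ultimately have "\<tau> differentiable at x"
    using differentiable_of_immersion_compose chart_has_derivative[OF \<theta> y] chart_inj_derivative[OF \<theta> y] \<tau>x
    by blast
  then show ?thesis
    using that W \<open>x \<in> W\<close> \<theta>\<tau> \<tau>x by blast
qed

text \<open>By the chain rule the derivative of the transition serves as \<open>T\<close> in both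
  equations. Having one \<open>T\<close> for the chart and for \<open>u\<close> is what makes the
  gradient independent of the chart.\<close>

lemma chart_transition_derivative:
  fixes M :: "'a::euclidean_space set" and U V :: "(real^'n::finite) set" and u :: "'a \<Rightarrow> real"
  assumes \<phi>: "chart M U \<phi>" and \<theta>: "chart M V \<theta>" and x: "x \<in> U" and y: "y \<in> V" and eq: "\<phi> x = \<theta> y"
    and u: "(u \<circ> \<theta>) differentiable at y"
  obtains T where "frechet_derivative \<phi> (at x) = frechet_derivative \<theta> (at y) \<circ> T"
    "frechet_derivative (u \<circ> \<phi>) (at x) = frechet_derivative (u \<circ> \<theta>) (at y) \<circ> T"
proof -
  obtain \<tau> W where W: "open W" "x \<in> W" and \<theta>\<tau>: "\<And>z. z \<in> W \<Longrightarrow> \<theta> (\<tau> z) = \<phi> z" and \<tau>: "\<tau> x = y" "\<tau> differentiable at x"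
    using chart_transition[OF \<phi> \<theta> x y eq] by blast
  have "frechet_derivative (\<theta> \<circ> \<tau>) (at x) = frechet_derivative \<phi> (at x)"
    using chart_differentiable[OF \<theta> y] \<tau>
    by (intro frechet_derivative_transform_within_open[OF differentiable_chain_at W]) (simp_all add: \<theta>\<tau>)
  moreover have "frechet_derivative ((u \<circ> \<theta>) \<circ> \<tau>) (at x) = frechet_derivative (u \<circ> \<phi>) (at x)"
    using u \<tau> by (intro frechet_derivative_transform_within_open[OF differentiable_chain_at W]) (simp_all add: \<theta>\<tau>)
  ultimately show ?thesis
    using frechet_derivative_compose[OF \<tau>(2), of \<theta>] frechet_derivative_compose[OF \<tau>(2), of "u \<circ> \<theta>"]
      chart_differentiable[OF \<theta> y] u \<tau>(1) that by metis
qed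

text \<open>The differential of \<open>h\<close> with its index raised by the inverse metric, as it
  occurs inside \<open>laplacian_in_chart\<close>.\<close>

definition grad_coord ::
  "('a::euclidean_space \<Rightarrow> 'a \<Rightarrow> 'a \<Rightarrow> real) \<Rightarrow> (real^'n::finite \<Rightarrow> 'a) \<Rightarrow> (real^'n \<Rightarrow> real) \<Rightarrow> real^'n \<Rightarrow> real^'n" where
  "grad_coord g \<phi> h x = matrix_inv (gram g \<phi> x) *v (\<chi> j. partial_deriv j h x)"

text \<open>A chart is chosen separately at each point; \<open>gradient_chart\<close> shows that the
  choice is immaterial for smooth \<open>u\<close>. A field defined on all of \<open>M\<close> is
  what the partition of unity can be applied to.\<close>

definition gradient ::
  "'n::finite itself \<Rightarrow> 'a::euclidean_space set \<Rightarrow> ('a \<Rightarrow> 'a \<Rightarrow> 'a \<Rightarrow> real) \<Rightarrow> ('a \<Rightarrow> real) \<Rightarrow> 'a \<Rightarrow> 'a" where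
  "gradient N M g u p = (SOME X. \<exists>(U :: (real^'n) set) \<phi> x. chart M U \<phi> \<and> x \<in> U \<and> \<phi> x = p \<and>
     X = frechet_derivative \<phi> (at x) (grad_coord g \<phi> (u \<circ> \<phi>) x))"

section \<open>The metric in the coordinates of one chart\<close>

context
  fixes M :: "'a::euclidean_space set" and g and U :: "(real^'n::finite) set" and \<phi>
  assumes metric: "riemannian_metric TYPE('n) M g" and chart: "chart M U \<phi>"
begin

lemma metric_sym:
  "x \<in> U \<Longrightarrow> g (\<phi> x) (frechet_derivative \<phi> (at x) v) (frechet_derivative \<phi> (at x) w)
    = g (\<phi> x) (frechet_derivative \<phi> (at x) w) (frechet_derivative \<phi> (at x) v)"
  using metric chart_mem[OF chart] chart_tangent[OF chart] unfolding riemannian_metric_def by blast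

lemma metric_linear_left:
  assumes x: "x \<in> U"
  shows "linear (\<lambda>v. g (\<phi> x) (frechet_derivative \<phi> (at x) v) (frechet_derivative \<phi> (at x) w))"
proof -
  define D where "D = frechet_derivative \<phi> (at x)"
  have lin: "linear D"
    unfolding D_def using chart_linear_derivative[OF chart x] .
  have tan: "D v \<in> tangent_space TYPE('n) M (\<phi> x)" for v
    unfolding D_def using chart_tangent[OF chart x] .
  have comb: "g (\<phi> x) (c *\<^sub>R D u + D v) (D w) = c * g (\<phi> x) (D u) (D w) + g (\<phi> x) (D v) (D w)" for c u v
    using metric chart_mem[OF chart x] tan unfolding riemannian_metric_def by blast
  \<comment> \<open>With zero vectors and \<open>c = 1\<close> the combination law reads
    \<open>z = z + z\<close>.\<close>
  have zero: "g (\<phi> x) (D 0) (D w) = 0"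
    using comb[of 1 0 0] linear_0[OF lin] by simp
  show ?thesis
    unfolding D_def[symmetric]
  proof (rule linearI)
    show "g (\<phi> x) (D (u + v)) (D w) = g (\<phi> x) (D u) (D w) + g (\<phi> x) (D v) (D w)" for u v
      using comb[of 1 u v] by (simp add: linear_add[OF lin])
    show "g (\<phi> x) (D (c *\<^sub>R u)) (D w) = c *\<^sub>R g (\<phi> x) (D u) (D w)" for c u
      using comb[of c u 0] zero by (simp add: linear_scale[OF lin] linear_0[OF lin])
  qed
qed

text \<open>Expansion of a bilinear form in a basis. The axioms give linearity in the first
  argument, so symmetry is used to expand the second.\<close>

lemma metric_eq_gram:
  assumes x: "x \<in> U"
  shows "g (\<phi> x) (frechet_derivative \<phi> (at x) v) (frechet_derivative \<phi> (at x) w) = v \<bullet> (gram g \<phi> x *v w)"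
proof -
  define D where "D = frechet_derivative \<phi> (at x)"
  define b where "b v w = g (\<phi> x) (D v) (D w)" for v w
  have lin: "linear (\<lambda>v. b v w)" for w
    unfolding b_def D_def by (rule metric_linear_left[OF x])
  have sym: "b v w = b w v" for v w
    unfolding b_def D_def by (rule metric_sym[OF x])
  have expand: "b v w = (\<Sum>i\<in>UNIV. v $ i * b (axis i 1) w)" for v w
  proof -
    have "b v w = b (\<Sum>i\<in>UNIV. v $ i *s axis i 1) w"
      by (simp add: basis_expansion)
    also have "\<dots> = (\<Sum>i\<in>UNIV. v $ i * b (axis i 1) w)"
      using linear_sum[OF lin, where g = "\<lambda>i. v $ i *\<^sub>R axis i 1"] linear_scale[OF lin]
      by (simp add: scalar_mult_eq_scaleR)
    finally show ?thesis .
  qed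
  have "b v w = (\<Sum>i\<in>UNIV. v $ i * (\<Sum>j\<in>UNIV. gram g \<phi> x $ i $ j * w $ j))"
    by (subst expand, subst sym, subst expand)
      (simp add: gram_def partial_deriv_def b_def D_def sym[unfolded b_def D_def] mult.commute)
  then show ?thesis
    by (simp add: b_def D_def inner_vec_def matrix_vector_mult_def)
qed

lemma gram_pos_def:
  assumes x: "x \<in> U" and "v \<noteq> 0"
  shows "v \<bullet> (gram g \<phi> x *v v) > 0"
proof -
  have "frechet_derivative \<phi> (at x) v \<noteq> 0"
    using chart_inj_derivative[OF chart x] linear_0[OF chart_linear_derivative[OF chart x]] \<open>v \<noteq> 0\<close>
    by (metis injD)
  then show ?thesis
    unfolding metric_eq_gram[OF x, symmetric]
    using metric chart_mem[OF chart x] chart_tangent[OF chart x] unfolding riemannian_metric_def by blast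
qed

lemma gram_det_pos: "x \<in> U \<Longrightarrow> det (gram g \<phi> x) > 0"
  by (intro pos_def_det_pos gram_pos_def)

lemma gram_C1_on: "C1_on U (\<lambda>x. gram g \<phi> x $ i $ j)"
  using metric chart smooth_on_imp_C1_on unfolding riemannian_metric_def by blast

lemma volume_density_C1_on: "C1_on U (\<lambda>x. sqrt (det (gram g \<phi> x)))"
  by (intro C1_on_sqrt C1_on_det gram_C1_on gram_det_pos)

lemma gram_inverse_C1_on: "C1_on U (\<lambda>x. matrix_inv (gram g \<phi> x) $ i $ j)"
  using gram_det_pos by (intro C1_on_matrix_inv chart_open[OF chart] gram_C1_on) force

text \<open>The Gram matrix cancels its inverse. Representing the differential characterizes the
  gradient, and its independence of the chart is derived from this property.\<close>

lemma metric_grad_coord: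
  assumes x: "x \<in> U" and h: "h differentiable at x"
  shows "g (\<phi> x) (frechet_derivative \<phi> (at x) v) (frechet_derivative \<phi> (at x) (grad_coord g \<phi> h x))
    = frechet_derivative h (at x) v"
proof -
  have "gram g \<phi> x *v grad_coord g \<phi> h x = (\<chi> j. partial_deriv j h x)"
    using matrix_inv_right[OF pos_def_invertible[OF gram_pos_def[OF x]]]
    by (simp add: grad_coord_def matrix_vector_mul_assoc)
  then show ?thesis
    by (simp add: metric_eq_gram[OF x] frechet_derivative_partial_deriv[OF h] inner_vec_def)
qed

end

lemma smooth_on_manifold_chart:
  fixes M :: "'a::euclidean_space set" and U :: "(real^'n::finite) set"
  assumes "smooth_on_manifold TYPE('n) M u" "chart M U \<phi>"
  shows "smooth_on U (u \<circ> \<phi>)"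
  using assms by (simp add: smooth_on_manifold_def)

lemma smooth_on_differentiable: "smooth_on S f \<Longrightarrow> x \<in> S \<Longrightarrow> f differentiable at x"
  using smooth_on_imp_C1_on by fastforce

text \<open>The vectors computed in the chosen chart and in \<open>\<phi>\<close> represent the same
  differential, and the metric is nondegenerate. The derivative \<open>T'\<close> moves the former
  into the coordinates of \<open>\<phi>\<close>.\<close>

lemma gradient_chart:
  fixes M :: "'a::euclidean_space set" and U :: "(real^'n::finite) set"
  assumes metric: "riemannian_metric TYPE('n) M g" and u: "smooth_on_manifold TYPE('n) M u"
    and \<phi>: "chart M U \<phi>" and x: "x \<in> U"
  shows "gradient TYPE('n) M g u (\<phi> x) = frechet_derivative \<phi> (at x) (grad_coord g \<phi> (u \<circ> \<phi>) x)"
proof -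
  have "\<exists>(V :: (real^'n) set) \<theta> y. chart M V \<theta> \<and> y \<in> V \<and> \<theta> y = \<phi> x \<and>
      gradient TYPE('n) M g u (\<phi> x) = frechet_derivative \<theta> (at y) (grad_coord g \<theta> (u \<circ> \<theta>) y)"
    unfolding gradient_def by (rule someI_ex) (use \<phi> x in blast)
  then obtain V \<theta> and y :: "real^'n" where \<theta>: "chart M V \<theta>" and y: "y \<in> V" "\<theta> y = \<phi> x"
    and grad: "gradient TYPE('n) M g u (\<phi> x) = frechet_derivative \<theta> (at y) (grad_coord g \<theta> (u \<circ> \<theta>) y)"
    by blast
  define a b where "a = grad_coord g \<phi> (u \<circ> \<phi>) x" and "b = grad_coord g \<theta> (u \<circ> \<theta>) y"
  have du: "(u \<circ> \<phi>) differentiable at x" "(u \<circ> \<theta>) differentiable at y"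
    using smooth_on_differentiable[OF smooth_on_manifold_chart[OF u]] \<phi> x \<theta> y by auto
  obtain T where T: "frechet_derivative \<phi> (at x) = frechet_derivative \<theta> (at y) \<circ> T"
    "frechet_derivative (u \<circ> \<phi>) (at x) = frechet_derivative (u \<circ> \<theta>) (at y) \<circ> T"
    using chart_transition_derivative[OF \<phi> \<theta> x y(1) y(2)[symmetric] du(2)] by blast
  obtain T' where T': "frechet_derivative \<theta> (at y) = frechet_derivative \<phi> (at x) \<circ> T'"
    using chart_transition_derivative[OF \<theta> \<phi> y(1) x y(2) du(1)] by blast
  have "v \<bullet> (gram g \<phi> x *v a) = v \<bullet> (gram g \<phi> x *v T' b)" for v
  proof -
    have "v \<bullet> (gram g \<phi> x *v T' b) = g (\<phi> x) (frechet_derivative \<phi> (at x) v) (frechet_derivative \<theta> (at y) b)"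
      by (simp add: metric_eq_gram[OF metric \<phi> x, symmetric] T')
    also have "\<dots> = g (\<theta> y) (frechet_derivative \<theta> (at y) (T v)) (frechet_derivative \<theta> (at y) b)"
      by (simp add: T(1) y)
    also have "\<dots> = frechet_derivative (u \<circ> \<phi>) (at x) v"
      unfolding b_def by (subst metric_grad_coord[OF metric \<theta> y(1) du(2)]) (simp add: T(2))
    also have "\<dots> = v \<bullet> (gram g \<phi> x *v a)"
      by (simp add: a_def metric_grad_coord[OF metric \<phi> x du(1)] metric_eq_gram[OF metric \<phi> x, symmetric])
    finally show ?thesis ..
  qed
  \<comment> \<open>Taking \<open>v\<close> to be the difference itself allows positive definiteness
    to finish.\<close>
  then have "(a - T' b) \<bullet> (gram g \<phi> x *v (a - T' b)) = 0"
    by (simp add: matrix_vector_mult_diff_distrib inner_diff_right)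
  then have "a - T' b = 0"
    using gram_pos_def[OF metric \<phi> x, of "a - T' b"] by auto
  then show ?thesis
    by (simp add: grad a_def[symmetric] b_def[symmetric] T')
qed

section \<open>Integration against the volume in one chart\<close>

lemma riemannian_volume_space:
  "riemannian_volume N M g \<mu> \<Longrightarrow> space \<mu> = M"
  unfolding riemannian_volume_def by (metis inf_top.right_neutral sets_eq_imp_space_eq space_borel space_restrict_space)

text \<open>On the chart image the volume is the image under \<open>\<phi>\<close> of Lebesgue
  measure with a density, so integrals transfer by the rules for densities and image
  measures.\<close>

lemma riemannian_volume_integral_chart:
  fixes M :: "'a::euclidean_space set" and U :: "(real^'n::finite) set" and Q :: "'a \<Rightarrow> real"
  assumes metric: "riemannian_metric TYPE('n) M g" and vol: "riemannian_volume TYPE('n) M g \<mu>"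
    and M: "M \<in> sets borel" and \<phi>: "chart M U \<phi>"
    and Q: "continuous_on U (\<lambda>x. Q (\<phi> x))" and supp: "\<And>p. p \<in> M - \<phi> ` U \<Longrightarrow> Q p = 0"
    and int: "has_bochner_integral lborel (\<lambda>x. indicator U x * (sqrt (det (gram g \<phi> x)) * Q (\<phi> x))) I"
  shows "has_bochner_integral \<mu> Q I"
proof -
  define w where "w x = sqrt (det (gram g \<phi> x))" for x
  have w_pos: "w x > 0" if "x \<in> U" for x
    using gram_det_pos[OF metric \<phi> that] by (simp add: w_def)
  have U: "U \<in> sets borel"
    using chart_open[OF \<phi>] by simp
  \<comment> \<open>Measurability of \<open>w\<close> and \<open>\<phi>\<close> is available only on
    \<open>U\<close>, hence the restricted spaces.\<close>
  define LU where "LU = restrict_space lborel U"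
  have sets_LU: "sets LU = sets (restrict_space borel U)" and space_LU: "space LU = U"
    by (auto simp: LU_def sets_restrict_space space_restrict_space)
  have "continuous_on U w"
    unfolding w_def by (rule C1_on_continuous[OF volume_density_C1_on[OF metric \<phi>]])
  from borel_measurable_continuous_on_restrict[OF this]
  have w_meas[measurable]: "w \<in> borel_measurable LU"
    by (subst measurable_cong_sets[OF sets_LU refl])
  obtain T where T: "open T" "\<phi> ` U = M \<inter> T"
    using chart_openin[OF \<phi>] by (auto simp: openin_open)
  then have \<phi>U: "\<phi> ` U \<in> sets borel"
    using M by auto
  have sets_\<mu>: "sets \<mu> = sets (restrict_space borel M)" and space_\<mu>: "space \<mu> = M"
    using vol riemannian_volume_space[OF vol] by (auto simp: riemannian_volume_def)
  have \<mu>_iff: "A \<in> sets \<mu> \<longleftrightarrow> A \<subseteq> M \<and> A \<in> sets borel" for A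
    unfolding sets_\<mu> using M by (subst sets_restrict_space_iff) auto
  then have \<phi>U_\<mu>: "\<phi> ` U \<inter> space \<mu> \<in> sets \<mu>"
    using \<phi>U chart_image_subset[OF \<phi>] space_\<mu> by (auto simp: Int_absorb2)
  define B where "B = restrict_space (borel :: 'a measure) (\<phi> ` U)"
  have "\<phi> \<in> measurable (restrict_space borel U) B"
    unfolding B_def using chart_continuous[OF \<phi>]
    by (intro measurable_restrict_space2 borel_measurable_continuous_on_restrict) (auto simp: space_restrict_space)
  then have \<phi>_meas[measurable]: "\<phi> \<in> measurable LU B"
    by (subst measurable_cong_sets[OF sets_LU refl])
  obtain \<psi> where \<psi>: "homeomorphism U (\<phi> ` U) \<phi> \<psi>"
    using chart_homeomorphism[OF \<phi>] by blast
  have "continuous_on (\<phi> ` U) (\<lambda>p. Q (\<phi> (\<psi> p)))"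
    by (rule continuous_on_compose2[OF Q homeomorphism_cont2[OF \<psi>]]) (use homeomorphism_image2[OF \<psi>] in simp)
  then have "continuous_on (\<phi> ` U) Q"
    by (rule continuous_on_eq) (use homeomorphism_apply2[OF \<psi>] in simp)
  then have Q_meas[measurable]: "Q \<in> borel_measurable B"
    unfolding B_def by (rule borel_measurable_continuous_on_restrict)
  define R where "R = restrict_space \<mu> (\<phi> ` U)"
  have sets_R: "A \<in> sets R \<longleftrightarrow> A \<subseteq> \<phi> ` U \<and> A \<in> sets borel" for A
    unfolding R_def sets_restrict_space_iff[OF \<phi>U_\<mu>] \<mu>_iff using chart_image_subset[OF \<phi>] by auto
  have sets_B: "A \<in> sets B \<longleftrightarrow> A \<subseteq> \<phi> ` U \<and> A \<in> sets borel" for A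
    unfolding B_def using \<phi>U by (subst sets_restrict_space_iff) auto
  \<comment> \<open>The defining formula of the volume for subsets of the chart image, read as an
    equality of measures.\<close>
  have R_eq: "R = distr (density LU w) B \<phi>"
  proof (rule measure_eqI)
    show "sets R = sets (distr (density LU w) B \<phi>)"
      using sets_R sets_B by auto
    fix A assume A: "A \<in> sets R"
    then have AB: "A \<in> sets B" and "A \<subseteq> \<phi> ` U" "A \<in> sets \<mu>"
      using sets_R sets_B \<mu>_iff chart_image_subset[OF \<phi>] by auto
    then have "emeasure R A = (\<integral>\<^sup>+x\<in>U \<inter> \<phi> -` A. ennreal (w x) \<partial>lborel)"
      using vol \<phi> \<phi>U_\<mu> unfolding R_def w_def riemannian_volume_def by (subst emeasure_restrict_space) auto
    also have "\<dots> = (\<integral>\<^sup>+x. ennreal (w x) * indicator (\<phi> -` A \<inter> U) x * indicator U x \<partial>lborel)"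
      by (intro nn_integral_cong) (auto split: split_indicator)
    also have "\<dots> = (\<integral>\<^sup>+x. ennreal (w x) * indicator (\<phi> -` A \<inter> U) x \<partial>LU)"
      unfolding LU_def using U by (subst nn_integral_restrict_space) auto
    also have "\<dots> = emeasure (density LU w) (\<phi> -` A \<inter> space (density LU w))"
      using measurable_sets[OF \<phi>_meas AB] by (subst emeasure_density) (auto simp: space_LU)
    also have "\<dots> = emeasure (distr (density LU w) B \<phi>) A"
      using AB by (subst emeasure_distr) auto
    finally show "emeasure R A = emeasure (distr (density LU w) B \<phi>) A" .
  qed
  have "has_bochner_integral LU (\<lambda>x. w x *\<^sub>R Q (\<phi> x)) I"
    using int U unfolding LU_def has_bochner_integral_iff w_def
    by (subst integrable_restrict_space, simp) (subst integral_restrict_space; simp)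
  then have "has_bochner_integral (density LU w) (\<lambda>x. Q (\<phi> x)) I"
    using w_pos by (intro has_bochner_integral_density) (auto simp: space_LU intro!: less_imp_le)
  then have "has_bochner_integral R Q I"
    unfolding R_eq by (intro has_bochner_integral_distr) auto
  then have "has_bochner_integral \<mu> (\<lambda>p. indicator (\<phi> ` U) p *\<^sub>R Q p) I"
    unfolding R_def has_bochner_integral_iff integrable_restrict_space[OF \<phi>U_\<mu>] integral_restrict_space[OF \<phi>U_\<mu>] .
  then show ?thesis
    by (rule has_bochner_integral_cong[THEN iffD1, rotated -1])
      (use supp in \<open>auto simp: space_\<mu> split: split_indicator\<close>)
qed


section \<open>The divergence theorem and Green's identity\<close>

text \<open>By translation invariance of Lebesgue measure, the difference quotients in direction \<open>v\<close>
  all have integral zero; dominated convergence passes to the limit.\<close>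

lemma integral_directional_derivative_compact_support:
  fixes H :: "'a::euclidean_space \<Rightarrow> real"
  assumes H: "C1_on UNIV H" and K: "compact K" and supp: "\<And>x. x \<notin> K \<Longrightarrow> H x = 0"
  shows "has_bochner_integral lborel (\<lambda>x. frechet_derivative H (at x) v) 0"
proof -
  define D where "D x = frechet_derivative H (at x) v" for x
  have D_cont: "continuous_on UNIV D"
    unfolding D_def by (rule C1_on_continuous_derivative[OF H])
  have H_cont: "continuous_on UNIV H"
    by (rule C1_on_continuous[OF H])
  have H_meas[measurable]: "H \<in> borel_measurable borel" and D_meas[measurable]: "D \<in> borel_measurable borel"
    using H_cont D_cont by (auto intro: borel_measurable_continuous_onI)
  have D_supp: "D x = 0" if "x \<notin> K" for x
  proof -
    have "frechet_derivative H (at x) = frechet_derivative (\<lambda>x. 0) (at x)"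
      using C1_on_has_derivative[OF H] that supp compact_imp_closed[OF K]
      by (intro frechet_derivative_transform_within_open[of _ _ "- K"]) (auto simp: differentiable_def)
    then show ?thesis
      by (simp add: D_def)
  qed
  obtain C where C: "C \<ge> 0" "\<And>x. \<bar>D x\<bar> \<le> C"
  proof -
    have "bounded (D ` K)"
      using K D_cont by (intro compact_imp_bounded compact_continuous_image) (auto intro: continuous_on_subset)
    then obtain C where "\<And>x. x \<in> K \<Longrightarrow> \<bar>D x\<bar> \<le> C" "C > 0"
      unfolding bounded_pos by auto
    then show ?thesis
      using that[of C] D_supp by (metis abs_zero less_eq_real_def)
  qed
  have line: "((\<lambda>t. H (x + t *\<^sub>R v)) has_real_derivative D (x + t *\<^sub>R v)) (at t)" for x t
  proof -
    have "((\<lambda>t. H (x + t *\<^sub>R v)) has_derivative (\<lambda>s. frechet_derivative H (at (x + t *\<^sub>R v)) (s *\<^sub>R v))) (at t)"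
      by (rule has_derivative_compose[OF _ C1_on_has_derivative[OF H UNIV_I]]) (auto intro!: derivative_eq_intros)
    moreover have "linear (frechet_derivative H (at (x + t *\<^sub>R v)))"
      using has_derivative_linear[OF C1_on_has_derivative[OF H UNIV_I]] .
    ultimately show ?thesis
      by (simp add: has_field_derivative_def D_def linear_scale mult.commute[of _ "frechet_derivative _ _ _"])
  qed
  define h where "h n = inverse (real (Suc n))" for n
  have h: "0 < h n" "h n \<le> 1" for n
    by (auto simp: h_def inverse_le_1_iff)
  define q where "q n x = (H (x + h n *\<^sub>R v) - H x) / h n" for n x
  \<comment> \<open>All segments of parameter length at most one in direction \<open>v\<close> or
    its opposite that start in \<open>K\<close>. For steps \<open>h n \<le> 1\<close> this set
    contains every \<open>x\<close> at which the quotient can be nonzero.\<close>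
  define K' where "K' = (\<lambda>(x, t). x + t *\<^sub>R v) ` (K \<times> {-1..1})"
  have "compact K'"
    unfolding K'_def using K
    by (intro compact_continuous_image compact_Times compact_Icc) (auto simp: case_prod_unfold intro!: continuous_intros)
  have q_bound: "norm (q n x) \<le> C * indicator K' x" for n x
  proof (cases "x \<in> K'")
    case True
    \<comment> \<open>The mean value theorem turns a bound on the derivative into a bound on all
      difference quotients.\<close>
    obtain z where "0 < z" "z < h n" "H (x + h n *\<^sub>R v) - H (x + 0 *\<^sub>R v) = (h n - 0) * D (x + z *\<^sub>R v)"
      using MVT2[OF h(1)[of n], of "\<lambda>t. H (x + t *\<^sub>R v)" "\<lambda>t. D (x + t *\<^sub>R v)"] line by blast
    then have "q n x = D (x + z *\<^sub>R v)"
      using h(1)[of n] by (simp add: q_def)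
    then show ?thesis
      using C True by simp
  next
    case False
    have "x \<notin> K"
    proof
      assume "x \<in> K"
      then have "(\<lambda>(x, t). x + t *\<^sub>R v) (x, 0) \<in> K'"
        unfolding K'_def by (intro imageI) simp
      then show False using False by simp
    qed
    moreover have "x + h n *\<^sub>R v \<notin> K"
    proof
      assume "x + h n *\<^sub>R v \<in> K"
      then have "(\<lambda>(x, t). x + t *\<^sub>R v) (x + h n *\<^sub>R v, - h n) \<in> K'"
        unfolding K'_def using h[of n] by (intro imageI) simp
      then show False using False by simp
    qed
    ultimately show ?thesis
      using C supp by (simp add: q_def)
  qed
  have H_int: "integrable lborel H"
  proof -
    have "integrable lborel (\<lambda>x. indicator K x *\<^sub>R H x)"
      using K H_cont by (intro borel_integrable_compact) (auto intro: continuous_on_subset)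
    moreover have "(\<lambda>x. indicator K x *\<^sub>R H x) = H"
      using supp by (auto simp: fun_eq_iff split: split_indicator)
    ultimately show ?thesis by metis
  qed
  have shift: "has_bochner_integral lborel (\<lambda>x. H (x + c)) (integral\<^sup>L lborel H)" for c
  proof -
    have "has_bochner_integral (distr lborel borel ((+) c)) H (integral\<^sup>L lborel H)"
      unfolding lborel_distr_plus using H_int by (rule has_bochner_integral_integrable)
    then show ?thesis
      by (simp add: has_bochner_integral_iff integrable_distr_eq integral_distr add.commute)
  qed
  have q_int: "has_bochner_integral lborel (q n) 0" for n
    using has_bochner_integral_divide_zero[OF has_bochner_integral_diff[OF shift[of "h n *\<^sub>R v"] shift[of 0]], of "h n"]
    by (simp add: q_def[abs_def])
  have "K' \<in> sets lborel" "emeasure lborel K' < \<infinity>"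
    using emeasure_compact_finite[OF \<open>compact K'\<close>] \<open>compact K'\<close> by (auto intro: compact_imp_closed borel_closed)
  then have dom: "integrable lborel (\<lambda>x. C * indicator K' x)"
    by simp
  have q_lim: "(\<lambda>n. q n x) \<longlonglongrightarrow> D x" for x
  proof -
    have "((\<lambda>t. (H (x + t *\<^sub>R v) - H x) / t) \<longlongrightarrow> D x) (at 0)"
      using line[of x 0] by (simp add: DERIV_def)
    moreover have "filterlim h (at 0) sequentially"
      unfolding filterlim_at using h LIMSEQ_inverse_real_of_nat by (auto simp: h_def[abs_def] less_imp_neq[THEN not_sym])
    ultimately show ?thesis
      unfolding q_def by (rule filterlim_compose)
  qed
  have q_meas: "q n \<in> borel_measurable lborel" for n
    unfolding q_def[abs_def] by measurable
  have D_meas': "D \<in> borel_measurable lborel"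
    by measurable
  have "integrable lborel D"
    by (rule integrable_dominated_convergence[where s = q, OF D_meas' q_meas dom])
      (use q_lim q_bound in simp_all)
  moreover have "(\<lambda>n. integral\<^sup>L lborel (q n)) \<longlonglongrightarrow> integral\<^sup>L lborel D"
    by (rule integral_dominated_convergence[where s = q, OF D_meas' q_meas dom])
      (use q_lim q_bound in simp_all)
  then have "integral\<^sup>L lborel D = 0"
    using q_int by (simp add: has_bochner_integral_iff LIMSEQ_const_iff)
  ultimately show ?thesis
    by (simp add: has_bochner_integral_iff D_def[abs_def])
qed

lemma linear_sum_Basis:
  fixes w :: "'a::euclidean_space"
  assumes "linear L"
  shows "L w = (\<Sum>b\<in>Basis. (w \<bullet> b) *\<^sub>R L b)"
proof -
  have "L w = L (\<Sum>b\<in>Basis. (w \<bullet> b) *\<^sub>R b)"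
    by (simp add: euclidean_representation)
  then show ?thesis
    using linear_sum[OF assms, where g = "\<lambda>b. (w \<bullet> b) *\<^sub>R b"] linear_scale[OF assms] by simp
qed

text \<open>In the chart, the vector field \<open>X\<close> is \<open>\<Sum>\<^sub>a F\<^sub>a \<partial>\<^sub>a \<phi> / sqrt (det g)\<close> and \<open>d\<close> is its divergence.\<close>

lemma divergence_local:
  fixes M :: "'a::euclidean_space set" and U :: "(real^'n::finite) set"
    and d :: "'a \<Rightarrow> real" and F :: "'n \<Rightarrow> real^'n \<Rightarrow> real"
  assumes metric: "riemannian_metric TYPE('n) M g" and vol: "riemannian_volume TYPE('n) M g \<mu>"
    and M: "M \<in> sets borel" and \<phi>: "chart M U \<phi>"
    and \<rho>: "\<And>p. p \<in> M \<Longrightarrow> (\<rho> has_derivative \<rho>' p) (at p)" and \<rho>': "\<And>v. continuous_on M (\<lambda>p. \<rho>' p v)"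
    and K: "compact K" "K \<subseteq> \<phi> ` U" and supp: "\<And>p. p \<in> M - K \<Longrightarrow> \<rho> p = 0 \<and> \<rho>' p = (\<lambda>v. 0)"
    and F: "\<And>a. C1_on U (F a)"
    and d: "\<And>x. x \<in> U \<Longrightarrow> sqrt (det (gram g \<phi> x)) * d (\<phi> x) = (\<Sum>a\<in>UNIV. partial_deriv a (F a) x)"
    and X: "\<And>x. x \<in> U \<Longrightarrow> sqrt (det (gram g \<phi> x)) *\<^sub>R X (\<phi> x) = (\<Sum>a\<in>UNIV. F a x *\<^sub>R partial_deriv a \<phi> x)"
  shows "has_bochner_integral \<mu> (\<lambda>p. \<rho> p * d p + \<rho>' p (X p)) 0"
proof -
  obtain \<psi> where \<psi>: "homeomorphism U (\<phi> ` U) \<phi> \<psi>"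
    using chart_homeomorphism[OF \<phi>] by blast
  define K0 where "K0 = \<psi> ` K"
  have K0: "compact K0" "K0 \<subseteq> U"
    unfolding K0_def using K homeomorphism_cont2[OF \<psi>] homeomorphism_image2[OF \<psi>]
    by (auto intro!: compact_continuous_image intro: continuous_on_subset)
  then have "open (- K0)"
    by (simp add: compact_imp_closed open_Compl)
  have \<phi>_notin: "\<phi> x \<notin> K" if "x \<in> U" "x \<notin> K0" for x
    using that homeomorphism_apply1[OF \<psi> that(1)] by (force simp: K0_def)
  have U: "open U"
    by (rule chart_open[OF \<phi>])
  have \<rho>'_lin: "linear (\<rho>' p)" if "p \<in> M" for p
    using \<rho>[OF that] by (rule has_derivative_linear)
  \<comment> \<open>\<open>H a\<close> is the cut-off flux in coordinates, extended by zero, and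
    \<open>E a x\<close> is its derivative by the product rule.\<close>
  define E where "E a x v = (if x \<in> U then \<rho> (\<phi> x) * frechet_derivative (F a) (at x) v
      + \<rho>' (\<phi> x) (frechet_derivative \<phi> (at x) v) * F a x else 0)" for a x v
  define H where "H a x = (if x \<in> U then \<rho> (\<phi> x) * F a x else 0)" for a x
  have H_supp: "H a x = 0" if "x \<notin> K0" for a x
    using supp[of "\<phi> x"] \<phi>_notin[OF _ that] chart_mem[OF \<phi>] by (auto simp: H_def)
  have E_supp: "E a x v = 0" if "x \<notin> K0" for a x v
    using supp[of "\<phi> x"] \<phi>_notin[OF _ that] chart_mem[OF \<phi>] by (auto simp: E_def)
  have H_deriv: "(H a has_derivative E a x) (at x)" for a x
  proof (cases "x \<in> U")
    case True
    have "((\<lambda>x. \<rho> (\<phi> x)) has_derivative (\<lambda>v. \<rho>' (\<phi> x) (frechet_derivative \<phi> (at x) v))) (at x)"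
      using has_derivative_compose[OF chart_has_derivative[OF \<phi> True] \<rho>[OF chart_mem[OF \<phi> True]]] .
    from has_derivative_mult[OF this C1_on_has_derivative[OF F True]]
    have "((\<lambda>x. \<rho> (\<phi> x) * F a x) has_derivative E a x) (at x)"
      using True by (simp add: E_def[abs_def])
    then show ?thesis
      by (rule has_derivative_transform_within_open[OF _ U True]) (simp add: H_def)
  next
    case False
    then have "x \<in> - K0"
      using K0 by blast
    have "((\<lambda>x. 0) has_derivative (\<lambda>v. 0)) (at x)"
      by (rule has_derivative_const)
    then have "(H a has_derivative (\<lambda>v. 0)) (at x)"
      by (rule has_derivative_transform_within_open[OF _ \<open>open (- K0)\<close> \<open>x \<in> - K0\<close>]) (simp add: H_supp)
    then show ?thesis
      using False by (simp add: E_def[abs_def])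
  qed
  have E_U: "continuous_on U (\<lambda>x. E a x v)" for a v
  proof -
    have \<rho>_cont: "continuous_on M \<rho>"
      using \<rho> by (meson continuous_at_imp_continuous_on has_derivative_continuous)
    have \<rho>\<phi>: "continuous_on U (\<lambda>x. \<rho> (\<phi> x))" "continuous_on U (\<lambda>x. \<rho>' (\<phi> x) b)" for b
      using continuous_on_compose2[OF \<rho>_cont chart_continuous[OF \<phi>] chart_image_subset[OF \<phi>]]
        continuous_on_compose2[OF \<rho>' chart_continuous[OF \<phi>] chart_image_subset[OF \<phi>]] by auto
    \<comment> \<open>Continuity of \<open>\<rho>'\<close> is given only for fixed vectors, so the
      vector moving with \<open>x\<close> is expanded in \<open>Basis\<close>.\<close>
    have "continuous_on U (\<lambda>x. \<rho> (\<phi> x) * frechet_derivative (F a) (at x) v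
        + (\<Sum>b\<in>Basis. (frechet_derivative \<phi> (at x) v \<bullet> b) *\<^sub>R \<rho>' (\<phi> x) b) * F a x)"
      by (intro continuous_intros \<rho>\<phi> C1_on_continuous[OF F] C1_on_continuous_derivative[OF F]
          C1_on_continuous_derivative[OF smooth_on_imp_C1_on[OF chart_smooth[OF \<phi>]]])
    then show ?thesis
      by (rule continuous_on_eq)
        (use linear_sum_Basis[OF \<rho>'_lin[OF chart_mem[OF \<phi>]]] in \<open>simp add: E_def\<close>)
  qed
  have "continuous_on UNIV (\<lambda>x. E a x v)" for a v
  proof -
    \<comment> \<open>The two open sets \<open>U\<close> and \<open>- K0\<close> cover the space
      because \<open>K0\<close> lies inside \<open>U\<close>.\<close>
    have "continuous_on (- K0) (\<lambda>x. E a x v)"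
      by (rule continuous_on_eq[OF continuous_on_const[of _ 0]]) (simp add: E_supp)
    then have "continuous_on (U \<union> - K0) (\<lambda>x. E a x v)"
      by (intro continuous_on_open_Un U \<open>open (- K0)\<close> E_U)
    moreover have "U \<union> - K0 = UNIV"
      using K0 by blast
    ultimately show ?thesis
      by simp
  qed
  then have "C1_on UNIV (H a)" for a
    by (intro C1_onI[OF H_deriv])
  then have "has_bochner_integral lborel (\<lambda>x. frechet_derivative (H a) (at x) v) 0" for a v
    using integral_directional_derivative_compact_support K0(1) H_supp by blast
  then have E_int: "has_bochner_integral lborel (\<lambda>x. E a x v) 0" for a v
    by (simp flip: frechet_derivative_at[OF H_deriv])
  \<comment> \<open>The divergence of the product of \<open>\<rho>\<close> and
    \<open>X\<close>.\<close>
  define Q where "Q p = \<rho> p * d p + \<rho>' p (X p)" for p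
  have w_pos: "sqrt (det (gram g \<phi> x)) > 0" if "x \<in> U" for x
    using gram_det_pos[OF metric \<phi> that] by simp
  have EQ: "(\<Sum>a\<in>UNIV. E a x (axis a 1)) = sqrt (det (gram g \<phi> x)) * Q (\<phi> x)" if "x \<in> U" for x
  proof -
    have lin: "linear (\<rho>' (\<phi> x))"
      by (rule \<rho>'_lin[OF chart_mem[OF \<phi> that]])
    have "(\<Sum>a\<in>UNIV. E a x (axis a 1)) = \<rho> (\<phi> x) * (\<Sum>a\<in>UNIV. partial_deriv a (F a) x)
        + \<rho>' (\<phi> x) (\<Sum>a\<in>UNIV. F a x *\<^sub>R partial_deriv a \<phi> x)"
      using that linear_sum[OF lin, where g = "\<lambda>a. F a x *\<^sub>R partial_deriv a \<phi> x"] linear_scale[OF lin]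
      by (simp add: E_def partial_deriv_def sum.distrib sum_distrib_left mult.commute)
    also have "\<dots> = sqrt (det (gram g \<phi> x)) * Q (\<phi> x)"
      by (simp add: d[OF that, symmetric] X[OF that, symmetric] linear_scale[OF lin] Q_def algebra_simps)
    finally show ?thesis .
  qed
  have "has_bochner_integral \<mu> Q 0"
  proof (rule riemannian_volume_integral_chart[OF metric vol M \<phi>])
    have "continuous_on U (\<lambda>x. (\<Sum>a\<in>UNIV. E a x (axis a 1)) / sqrt (det (gram g \<phi> x)))"
      using w_pos by (intro continuous_on_divide continuous_on_sum E_U
          C1_on_continuous[OF volume_density_C1_on[OF metric \<phi>]]) force
    then show "continuous_on U (\<lambda>x. Q (\<phi> x))"
      by (rule continuous_on_eq) (use w_pos in \<open>force simp: EQ\<close>)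
    show "Q p = 0" if "p \<in> M - \<phi> ` U" for p
    proof -
      have "p \<in> M - K"
        using that K(2) by blast
      then show ?thesis
        using supp by (simp add: Q_def)
    qed
    have "has_bochner_integral lborel (\<lambda>x. \<Sum>a\<in>UNIV. E a x (axis a 1)) (\<Sum>a\<in>(UNIV::'n set). 0)"
      by (intro has_bochner_integral_sum E_int)
    moreover have "(\<Sum>a\<in>UNIV. E a x (axis a 1)) = indicator U x * (sqrt (det (gram g \<phi> x)) * Q (\<phi> x))" for x
      using EQ[of x] by (simp add: E_def split: split_indicator)
    ultimately show "has_bochner_integral lborel (\<lambda>x. indicator U x * (sqrt (det (gram g \<phi> x)) * Q (\<phi> x))) 0"
      by simp
  qed
  then show ?thesis
    by (simp add: Q_def[abs_def])
qed

section \<open>A continuously differentiable partition of unity\<close>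

lemma has_real_derivative_max_0_square:
  "((\<lambda>t::real. (max 0 t)\<^sup>2) has_real_derivative 2 * max 0 t) (at t)"
proof -
  consider "t > 0" | "t < 0" | "t = 0" by linarith
  then show ?thesis
  proof cases
    case 1
    have "((\<lambda>t::real. t\<^sup>2) has_real_derivative 2 * t) (at t)"
      by (auto intro!: derivative_eq_intros)
    then show ?thesis
      by (rule has_field_derivative_transform_within_open[of _ _ _ "{0<..}", THEN DERIV_cong])
        (use 1 in simp_all)
  next
    case 2
    have "((\<lambda>t::real. 0) has_real_derivative 0) (at t)"
      by simp
    then show ?thesis
      by (rule has_field_derivative_transform_within_open[of _ _ _ "{..<0}", THEN DERIV_cong])
        (use 2 in simp_all)
  next
    case 3
    \<comment> \<open>Squaring removes the kink: the quotient is \<open>h\<close> for positive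
      \<open>h\<close> and 0 for negative \<open>h\<close>.\<close>
    have "((\<lambda>h::real. (max 0 h)\<^sup>2 / h) \<longlongrightarrow> 0) (at 0)"
    proof (rule Lim_null_comparison)
      show "\<forall>\<^sub>F h in at 0. norm ((max 0 h)\<^sup>2 / h) \<le> \<bar>h\<bar>" for h :: real
        by (intro always_eventually) (auto simp: max_def power2_eq_square)
      show "((\<lambda>h::real. \<bar>h\<bar>) \<longlongrightarrow> 0) (at 0)"
        by (auto intro!: tendsto_eq_intros)
    qed
    then show ?thesis
      using 3 by (simp add: DERIV_def)
  qed
qed


text \<open>The partition of unity consists of the normalized bumps \<open>(max 0 (r\<^sup>2 - \<parallel>y - p\<parallel>\<^sup>2))\<^sup>2\<close>
  of the ambient space, which are continuously differentiable and vanish outside the ball of radius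
  \<open>r\<close>.\<close>

lemma compact_partition_of_unity:
  fixes M :: "'a::euclidean_space set"
  assumes M: "compact M" and r: "\<forall>p\<in>M. r p > 0"
  shows "\<exists>P \<rho> \<rho>'. finite P \<and> P \<subseteq> M \<and>
    (\<forall>p. \<forall>y\<in>M. (\<rho> p has_derivative \<rho>' p y) (at y)) \<and>
    (\<forall>p v. continuous_on M (\<lambda>y. \<rho>' p y v)) \<and>
    (\<forall>p y. y \<notin> ball p (r p) \<longrightarrow> \<rho> p y = (0::real) \<and> \<rho>' p y = (\<lambda>v. 0)) \<and>
    (\<forall>y\<in>M. (\<Sum>p\<in>P. \<rho> p y) = 1 \<and> (\<forall>v. (\<Sum>p\<in>P. \<rho>' p y v) = 0))"
proof -
  have "M \<subseteq> (\<Union>p\<in>M. ball p (r p))"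
    using r by force
  then obtain P where P: "P \<subseteq> M" "finite P" "M \<subseteq> (\<Union>p\<in>P. ball p (r p))"
    by (rule compactE_image[OF M open_ball])
  define s where "s p y = (r p)\<^sup>2 - (y - p) \<bullet> (y - p)" for p y
  define b where "b p y = (max 0 (s p y))\<^sup>2" for p y
  \<comment> \<open>One factor 2 comes from the outer square, the other from the squared
    distance.\<close>
  define b' where "b' p y v = - (4 * max 0 (s p y) * ((y - p) \<bullet> v))" for p y v
  have b: "(b p has_derivative b' p y) (at y)" for p y
  proof -
    have "(s p has_derivative (\<lambda>v. - (2 * ((y - p) \<bullet> v)))) (at y)"
      unfolding s_def by (auto intro!: derivative_eq_intros simp: inner_commute)
    from has_derivative_compose[OF this has_real_derivative_max_0_square[unfolded has_field_derivative_def]]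
    show ?thesis
      by (simp add: b_def[abs_def] b'_def[abs_def] algebra_simps)
  qed
  have s_neg: "s p y \<le> 0" if "y \<notin> ball p (r p)" "p \<in> P" for p y
  proof -
    have "r p \<le> norm (y - p)" "r p > 0"
      using that r P by (auto simp: dist_norm norm_minus_commute)
    then show ?thesis
      by (simp add: s_def power2_norm_eq_inner[symmetric] power_mono)
  qed
  define B where "B y = (\<Sum>p\<in>P. b p y)" for y
  define B' where "B' y v = (\<Sum>p\<in>P. b' p y v)" for y v
  have B: "(B has_derivative B' y) (at y)" for y
    unfolding B_def B'_def using b by (intro has_derivative_sum)
  have B_pos: "B y > 0" if yM: "y \<in> M" for y
  proof -
    obtain p where p: "p \<in> P" "y \<in> ball p (r p)"
      using P(3) yM by blast
    then have "norm (y - p) < r p"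
      by (simp add: dist_norm norm_minus_commute)
    then have "s p y > 0"
      by (simp add: s_def power2_norm_eq_inner[symmetric] power_strict_mono)
    then have "b p y > 0"
      by (simp add: b_def)
    then show ?thesis
      unfolding B_def using p(1) P(2) by (intro sum_pos2) (auto simp: b_def)
  qed
  \<comment> \<open>The support claim ranges over all \<open>p\<close>; restricting to
    \<open>P\<close> makes it true also where \<open>r p\<close> may be nonpositive.\<close>
  define \<rho> where "\<rho> p y = (if p \<in> P then b p y / B y else 0)" for p y
  define \<rho>' where "\<rho>' p y v = (if p \<in> P then (b' p y v * B y - b p y * B' y v) / (B y * B y) else 0)" for p y v
  show ?thesis
  proof (intro exI conjI allI ballI impI)
    show "finite P" "P \<subseteq> M"
      by (fact P)+
    show "(\<rho> p has_derivative \<rho>' p y) (at y)" if "y \<in> M" for p y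
    proof (cases "p \<in> P")
      case True
      then show ?thesis
        using has_derivative_divide'[OF b[of p y] B[of y]] B_pos[OF that]
        by (simp add: \<rho>_def[abs_def] \<rho>'_def[abs_def])
    qed (simp add: \<rho>_def[abs_def] \<rho>'_def[abs_def])
    have sc: "continuous_on M (s p)" for p
      unfolding s_def by (intro continuous_intros)
    have bc: "continuous_on M (b p)" "continuous_on M (\<lambda>y. b' p y v)" for p v
      unfolding b_def b'_def by (intro continuous_intros sc)+
    have Bc: "continuous_on M B" "continuous_on M (\<lambda>y. B' y v)" for v
      unfolding B_def B'_def by (intro continuous_on_sum bc)+
    show "continuous_on M (\<lambda>y. \<rho>' p y v)" for p v
      using B_pos by (cases "p \<in> P") (force simp: \<rho>'_def intro!: continuous_intros bc Bc)+
    show "\<rho> p y = 0" "\<rho>' p y = (\<lambda>v. 0)" if "y \<notin> ball p (r p)" for p y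
    proof -
      have "max 0 (s p y) = 0" if "p \<in> P"
        using s_neg[OF \<open>y \<notin> ball p (r p)\<close> that] by simp
      then show "\<rho> p y = 0" "\<rho>' p y = (\<lambda>v. 0)"
        by (auto simp: \<rho>_def \<rho>'_def[abs_def] b_def b'_def)
    qed
    show "(\<Sum>p\<in>P. \<rho> p y) = 1" if "y \<in> M" for y
      using B_pos[OF that] by (simp add: \<rho>_def sum_divide_distrib[symmetric] B_def[symmetric])
    show "(\<Sum>p\<in>P. \<rho>' p y v) = 0" if "y \<in> M" for y v
      by (simp add: \<rho>'_def sum_divide_distrib[symmetric] sum_subtractf sum_distrib_right[symmetric]
          B_def[symmetric] B'_def[symmetric])
  qed
qed

text \<open>Each \<open>\<rho> p\<close> is supported in one chart, where
  \<open>divergence_local\<close> applies. Summation over \<open>P\<close> leaves \<open>d\<close>,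
  because the functions add up to one and their derivatives to zero.\<close>

theorem divergence_theorem:
  fixes M :: "'a::euclidean_space set" and d :: "'a \<Rightarrow> real"
  assumes M: "closed_riemannian_manifold TYPE('n::finite) M g" and vol: "riemannian_volume TYPE('n) M g \<mu>"
    and div: "\<And>(U :: (real^'n) set) \<phi>. chart M U \<phi> \<Longrightarrow> \<exists>F :: 'n \<Rightarrow> real^'n \<Rightarrow> real. (\<forall>a. C1_on U (F a)) \<and>
      (\<forall>x\<in>U. sqrt (det (gram g \<phi> x)) * d (\<phi> x) = (\<Sum>a\<in>UNIV. partial_deriv a (F a) x) \<and>
        sqrt (det (gram g \<phi> x)) *\<^sub>R X (\<phi> x) = (\<Sum>a\<in>UNIV. F a x *\<^sub>R partial_deriv a \<phi> x))"
  shows "has_bochner_integral \<mu> d 0"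
proof -
  have compact: "compact M" and sub: "smooth_submanifold TYPE('n) M" and metric: "riemannian_metric TYPE('n) M g"
    using M by (auto simp: closed_riemannian_manifold_def)
  \<comment> \<open>Closed balls make \<open>M \<inter> cball p r\<close> a compact set containing
    the support.\<close>
  have "\<exists>(U :: (real^'n) set) \<phi> r. chart M U \<phi> \<and> r > 0 \<and> M \<inter> cball p r \<subseteq> \<phi> ` U" if "p \<in> M" for p
  proof -
    obtain U :: "(real^'n) set" and \<phi> where \<phi>: "chart M U \<phi>" and p: "p \<in> \<phi> ` U"
      using sub \<open>p \<in> M\<close> unfolding smooth_submanifold_def by blast
    then obtain T where T: "open T" "\<phi> ` U = M \<inter> T"
      using chart_openin[OF \<phi>] by (auto simp: openin_open)
    then obtain r where "r > 0" "cball p r \<subseteq> T"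
      using p open_contains_cball by blast
    then show ?thesis
      using \<phi> T by blast
  qed
  then obtain U :: "'a \<Rightarrow> (real^'n) set" and \<phi> r where \<phi>: "\<And>p. p \<in> M \<Longrightarrow> chart M (U p) (\<phi> p)"
    and r: "\<And>p. p \<in> M \<Longrightarrow> r p > 0" and cover: "\<And>p. p \<in> M \<Longrightarrow> M \<inter> cball p (r p) \<subseteq> \<phi> p ` U p"
    by metis
  have "\<forall>p\<in>M. r p > 0"
    using r by blast
  from compact_partition_of_unity[OF compact this]
  obtain P \<rho> \<rho>' where P: "finite P" "P \<subseteq> M"
    and unity: "\<forall>p. \<forall>y\<in>M. (\<rho> p has_derivative \<rho>' p y) (at y)"
      "\<forall>p v. continuous_on M (\<lambda>y. \<rho>' p y v)"
      "\<forall>p y. y \<notin> ball p (r p) \<longrightarrow> \<rho> p y = (0::real) \<and> \<rho>' p y = (\<lambda>v. 0)"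
      "\<forall>y\<in>M. (\<Sum>p\<in>P. \<rho> p y) = 1 \<and> (\<forall>v. (\<Sum>p\<in>P. \<rho>' p y v) = 0)"
    by (elim exE conjE) (rule that)
  have \<rho>: "(\<rho> p has_derivative \<rho>' p y) (at y)" and sum1: "(\<Sum>p\<in>P. \<rho> p y) = 1"
    and sum0: "(\<Sum>p\<in>P. \<rho>' p y v) = 0" if "y \<in> M" for p y v
    using unity that by auto
  have \<rho>': "continuous_on M (\<lambda>y. \<rho>' p y v)" for p v
    using unity by auto
  have supp: "\<rho> p y = 0 \<and> \<rho>' p y = (\<lambda>v. 0)" if "y \<notin> ball p (r p)" for p y
    using unity that by auto
  have "has_bochner_integral \<mu> (\<lambda>y. \<rho> p y * d y + \<rho>' p y (X y)) 0" if p: "p \<in> P" for p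
  proof -
    have "p \<in> M"
      using p P by blast
    obtain F :: "'n \<Rightarrow> real^'n \<Rightarrow> real" where F: "\<And>a. C1_on (U p) (F a)"
      and dX: "\<And>x. x \<in> U p \<Longrightarrow> sqrt (det (gram g (\<phi> p) x)) * d (\<phi> p x) = (\<Sum>a\<in>UNIV. partial_deriv a (F a) x)"
        "\<And>x. x \<in> U p \<Longrightarrow> sqrt (det (gram g (\<phi> p) x)) *\<^sub>R X (\<phi> p x) = (\<Sum>a\<in>UNIV. F a x *\<^sub>R partial_deriv a (\<phi> p) x)"
      using div[OF \<phi>[OF \<open>p \<in> M\<close>]] by blast
    show ?thesis
    proof (rule divergence_local[OF metric vol _ \<phi>[OF \<open>p \<in> M\<close>] \<rho> \<rho>' _ cover[OF \<open>p \<in> M\<close>] _ F dX])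
      show "M \<in> sets borel"
        using compact by (simp add: compact_imp_closed)
      show "compact (M \<inter> cball p (r p))"
        using compact by (simp add: compact_Int)
      show "\<rho> p y = 0 \<and> \<rho>' p y = (\<lambda>v. 0)" if "y \<in> M - M \<inter> cball p (r p)" for y
        using that supp[of y p] by auto
    qed
  qed
  then have "has_bochner_integral \<mu> (\<lambda>y. \<Sum>p\<in>P. \<rho> p y * d y + \<rho>' p y (X y)) (\<Sum>p\<in>P. 0)"
    by (rule has_bochner_integral_sum)
  then have "has_bochner_integral \<mu> (\<lambda>y. \<Sum>p\<in>P. \<rho> p y * d y + \<rho>' p y (X y)) 0"
    by simp
  then show ?thesis
    by (rule has_bochner_integral_cong[THEN iffD1, rotated -1])
      (simp_all add: riemannian_volume_space[OF vol] sum.distrib sum_distrib_right[symmetric] sum0 sum1)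
qed

text \<open>The divergence theorem for the vector field \<open>u \<nabla>w\<close>.\<close>

lemma green_identity:
  fixes M :: "'a::euclidean_space set" and u w lw :: "'a \<Rightarrow> real"
  assumes M: "closed_riemannian_manifold TYPE('n::finite) M g" and vol: "riemannian_volume TYPE('n) M g \<mu>"
    and u: "smooth_on_manifold TYPE('n) M u" and lw: "has_laplacian TYPE('n) M g w lw"
  shows "has_bochner_integral \<mu>
    (\<lambda>p. u p * lw p + g p (gradient TYPE('n) M g u p) (gradient TYPE('n) M g w p)) 0"
proof (rule divergence_theorem[OF M vol])
  have metric: "riemannian_metric TYPE('n) M g"
    using M by (simp add: closed_riemannian_manifold_def)
  have w: "smooth_on_manifold TYPE('n) M w"
    using lw by (simp add: has_laplacian_def)
  fix U :: "(real^'n) set" and \<phi> assume \<phi>: "chart M U \<phi>"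
  define D where "D x = sqrt (det (gram g \<phi> x))" for x
  \<comment> \<open>The flux of the gradient of \<open>w\<close>; the sum of its partial derivatives
    is the density times the Laplacian.\<close>
  define W where "W a x = D x * grad_coord g \<phi> (w \<circ> \<phi>) x $ a" for a x
  define F where "F a x = u (\<phi> x) * W a x" for a x
  have D_pos: "D x > 0" if "x \<in> U" for x
    using gram_det_pos[OF metric \<phi> that] by (simp add: D_def)
  have us: "C1_on U (\<lambda>x. u (\<phi> x))" and ws: "smooth_on U (w \<circ> \<phi>)"
    using smooth_on_manifold_chart[OF u \<phi>] smooth_on_manifold_chart[OF w \<phi>] smooth_on_imp_C1_on
    by (auto simp: comp_def)
  have W_C1: "C1_on U (W a)" for a
    unfolding W_def grad_coord_def matrix_vector_mult_def vec_lambda_beta D_def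
    by (intro C1_on_mult C1_on_sum volume_density_C1_on[OF metric \<phi>] gram_inverse_C1_on[OF metric \<phi>]
        smooth_on_imp_C1_on[OF smooth_on_derivative[OF ws, of "axis _ 1", folded partial_deriv_def]])
  have F_C1: "C1_on U (F a)" for a
    unfolding F_def by (intro C1_on_mult us W_C1)
  moreover have "D x * (u (\<phi> x) * lw (\<phi> x) + g (\<phi> x) (gradient TYPE('n) M g u (\<phi> x)) (gradient TYPE('n) M g w (\<phi> x)))
      = (\<Sum>a\<in>UNIV. partial_deriv a (F a) x)" if x: "x \<in> U" for x
  proof -
    have du: "(u \<circ> \<phi>) differentiable at x"
      using smooth_on_differentiable[OF smooth_on_manifold_chart[OF u \<phi>] x] .
    have "lw (\<phi> x) = laplacian_in_chart g \<phi> (w \<circ> \<phi>) x"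
      using lw \<phi> x by (simp add: has_laplacian_def)
    then have lap: "D x * lw (\<phi> x) = (\<Sum>a\<in>UNIV. partial_deriv a (W a) x)"
      using D_pos[OF x]
      by (simp add: laplacian_in_chart_def W_def[abs_def] D_def grad_coord_def matrix_vector_mult_def)
    have "g (\<phi> x) (gradient TYPE('n) M g u (\<phi> x)) (gradient TYPE('n) M g w (\<phi> x))
        = frechet_derivative (u \<circ> \<phi>) (at x) (grad_coord g \<phi> (w \<circ> \<phi>) x)"
      unfolding gradient_chart[OF metric u \<phi> x] gradient_chart[OF metric w \<phi> x]
      by (subst metric_sym[OF metric \<phi> x]) (rule metric_grad_coord[OF metric \<phi> x du])
    also have "\<dots> = (\<Sum>a\<in>UNIV. grad_coord g \<phi> (w \<circ> \<phi>) x $ a * partial_deriv a (u \<circ> \<phi>) x)"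
      by (simp add: frechet_derivative_partial_deriv[OF du])
    finally have grad: "D x * g (\<phi> x) (gradient TYPE('n) M g u (\<phi> x)) (gradient TYPE('n) M g w (\<phi> x))
        = (\<Sum>a\<in>UNIV. partial_deriv a (u \<circ> \<phi>) x * W a x)"
      by (simp add: W_def sum_distrib_left mult_ac)
    have "partial_deriv a (F a) x = u (\<phi> x) * partial_deriv a (W a) x + partial_deriv a (u \<circ> \<phi>) x * W a x" for a
    proof -
      have "(F a has_derivative (\<lambda>v. u (\<phi> x) * frechet_derivative (W a) (at x) v
          + frechet_derivative (\<lambda>x. u (\<phi> x)) (at x) v * W a x)) (at x)"
        unfolding F_def using has_derivative_mult[OF C1_on_has_derivative[OF us x] C1_on_has_derivative[OF W_C1 x]] .
      from frechet_derivative_at[OF this, symmetric] show ?thesis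
        by (simp add: partial_deriv_def comp_def)
    qed
    then show ?thesis
      by (simp add: ring_distribs grad sum.distrib sum_distrib_left[symmetric] lap[symmetric] mult.left_commute)
  qed
  moreover have "D x *\<^sub>R (u (\<phi> x) *\<^sub>R gradient TYPE('n) M g w (\<phi> x)) = (\<Sum>a\<in>UNIV. F a x *\<^sub>R partial_deriv a \<phi> x)"
    if x: "x \<in> U" for x
    by (simp add: gradient_chart[OF metric w \<phi> x] frechet_derivative_partial_deriv[OF chart_differentiable[OF \<phi> x]]
        F_def W_def scaleR_sum_right mult_ac)
  ultimately show "\<exists>F :: 'n \<Rightarrow> real^'n \<Rightarrow> real. (\<forall>a. C1_on U (F a)) \<and>
      (\<forall>x\<in>U. sqrt (det (gram g \<phi> x)) * (u (\<phi> x) * lw (\<phi> x)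
          + g (\<phi> x) (gradient TYPE('n) M g u (\<phi> x)) (gradient TYPE('n) M g w (\<phi> x)))
        = (\<Sum>a\<in>UNIV. partial_deriv a (F a) x) \<and>
        sqrt (det (gram g \<phi> x)) *\<^sub>R (\<lambda>p. u p *\<^sub>R gradient TYPE('n) M g w p) (\<phi> x)
        = (\<Sum>a\<in>UNIV. F a x *\<^sub>R partial_deriv a \<phi> x))"
    unfolding D_def by blast
qed

section \<open>Consequences for Laplace eigenfunctions\<close>

lemma metric_gradient:
  fixes M :: "'a::euclidean_space set"
  assumes M: "closed_riemannian_manifold TYPE('n::finite) M g" and p: "p \<in> M"
    and u: "smooth_on_manifold TYPE('n) M u" and w: "smooth_on_manifold TYPE('n) M w"
  shows metric_gradient_sym: "g p (gradient TYPE('n) M g u p) (gradient TYPE('n) M g w p)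
      = g p (gradient TYPE('n) M g w p) (gradient TYPE('n) M g u p)"
    and metric_gradient_nonneg: "g p (gradient TYPE('n) M g u p) (gradient TYPE('n) M g u p) \<ge> 0"
proof -
  have metric: "riemannian_metric TYPE('n) M g"
    using M by (simp add: closed_riemannian_manifold_def)
  obtain U :: "(real^'n) set" and \<phi> x where \<phi>: "chart M U \<phi>" and x: "x \<in> U" "p = \<phi> x"
    using M p unfolding closed_riemannian_manifold_def smooth_submanifold_def by blast
  show "g p (gradient TYPE('n) M g u p) (gradient TYPE('n) M g w p)
      = g p (gradient TYPE('n) M g w p) (gradient TYPE('n) M g u p)"
    unfolding x(2) gradient_chart[OF metric u \<phi> x(1)] gradient_chart[OF metric w \<phi> x(1)]
    by (rule metric_sym[OF metric \<phi> x(1)])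
  show "g p (gradient TYPE('n) M g u p) (gradient TYPE('n) M g u p) \<ge> 0"
    unfolding x(2) gradient_chart[OF metric u \<phi> x(1)] metric_eq_gram[OF metric \<phi> x(1)]
    using gram_pos_def[OF metric \<phi> x(1)] by (metis inner_zero_left less_imp_le order_refl)
qed

context
  fixes M :: "'a::euclidean_space set" and g \<mu> and u w :: "'a \<Rightarrow> real" and l l' :: real
  assumes M: "closed_riemannian_manifold TYPE('n::finite) M g" and vol: "riemannian_volume TYPE('n) M g \<mu>"
    and u: "has_laplacian TYPE('n) M g u (\<lambda>p. - (l * u p))" "u \<in> L2 \<mu>"
begin

text \<open>Subtracting Green's identity with \<open>u\<close> and \<open>w\<close> exchanged
  cancels the gradient terms by symmetry and leaves \<open>(l - l') * (u p * w p)\<close>.\<close>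

lemma eigenfunctions_orthogonal:
  assumes w: "has_laplacian TYPE('n) M g w (\<lambda>p. - (l' * w p))" "w \<in> L2 \<mu>" and "l \<noteq> l'"
  shows "L2_inner \<mu> u w = 0"
proof -
  have s: "smooth_on_manifold TYPE('n) M u" "smooth_on_manifold TYPE('n) M w"
    using u w by (auto simp: has_laplacian_def)
  have "has_bochner_integral \<mu> (\<lambda>p. (l - l') * (u p * w p)) (0 - 0)"
    by (rule has_bochner_integral_cong[THEN iffD1, OF refl _ refl
        has_bochner_integral_diff[OF green_identity[OF M vol s(1) w(1)] green_identity[OF M vol s(2) u(1)]]])
      (simp add: riemannian_volume_space[OF vol] metric_gradient_sym[OF M _ s] algebra_simps)
  then show ?thesis
    using \<open>l \<noteq> l'\<close> by (simp add: has_bochner_integral_iff L2_inner_def)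
qed

text \<open>Green's identity for \<open>u\<close> with itself equates \<open>l\<close> with the
  Dirichlet energy of the normalized eigenfunction.\<close>

lemma eigenvalue_nonneg:
  assumes "L2_inner \<mu> u u = 1"
  shows "l \<ge> 0"
proof -
  have s: "smooth_on_manifold TYPE('n) M u"
    using u by (auto simp: has_laplacian_def)
  have "has_bochner_integral \<mu> (\<lambda>p. l * (u p * u p)) (l * 1)"
    using L2_integrable_mult[OF u(2) u(2)] assms
    by (intro has_bochner_integral_mult_right) (auto simp: has_bochner_integral_iff L2_inner_def)
  then have "has_bochner_integral \<mu>
      (\<lambda>p. g p (gradient TYPE('n) M g u p) (gradient TYPE('n) M g u p)) (0 + l * 1)"
    by (intro has_bochner_integral_cong[THEN iffD1, OF refl _ refl
          has_bochner_integral_add[OF green_identity[OF M vol s u(1)]]])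
      (simp_all add: algebra_simps)
  then have "(\<integral>p. g p (gradient TYPE('n) M g u p) (gradient TYPE('n) M g u p) \<partial>\<mu>) = l"
    by (simp add: has_bochner_integral_iff)
  moreover have "(\<integral>p. g p (gradient TYPE('n) M g u p) (gradient TYPE('n) M g u p) \<partial>\<mu>) \<ge> 0"
    by (intro Bochner_Integration.integral_nonneg_AE AE_I2)
      (simp add: riemannian_volume_space[OF vol] metric_gradient_nonneg[OF M _ s s])
  ultimately show ?thesis
    by simp
qed

end


section \<open>Isometries\<close>

text \<open>Composition with the continuous inverse of a chart gives continuity on the chart image,
  which is a neighbourhood of \<open>p\<close> relative to \<open>M\<close>.\<close>

lemma smooth_on_manifold_continuous:
  fixes M :: "'a::euclidean_space set"
  assumes M: "smooth_submanifold TYPE('n::finite) M" and f: "smooth_on_manifold TYPE('n) M f"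
  shows "continuous_on M f"
  unfolding continuous_on_eq_continuous_within
proof
  fix p assume "p \<in> M"
  then obtain U :: "(real^'n) set" and \<phi> where \<phi>: "chart M U \<phi>" and p: "p \<in> \<phi> ` U"
    using M unfolding smooth_submanifold_def by blast
  obtain \<psi> where \<psi>: "homeomorphism U (\<phi> ` U) \<phi> \<psi>"
    using chart_homeomorphism[OF \<phi>] by blast
  have fc: "continuous_on U (f \<circ> \<phi>)"
    by (rule C1_on_continuous[OF smooth_on_imp_C1_on[OF smooth_on_manifold_chart[OF f \<phi>]]])
  have "continuous_on (\<phi> ` U) (\<lambda>p. (f \<circ> \<phi>) (\<psi> p))"
    by (rule continuous_on_compose2[OF fc homeomorphism_cont2[OF \<psi>]]) (use homeomorphism_image2[OF \<psi>] in simp)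
  then have "continuous_on (\<phi> ` U) f"
    by (rule continuous_on_eq) (use homeomorphism_apply2[OF \<psi>] in simp)
  then have *: "continuous (at p within \<phi> ` U) f"
    using p by (auto simp: continuous_on_eq_continuous_within)
  obtain T where T: "open T" "\<phi> ` U = M \<inter> T"
    using chart_openin[OF \<phi>] by (auto simp: openin_open)
  have "at p within \<phi> ` U = at p within M"
    by (rule at_within_nhd[of p T]) (use T p in auto)
  then show "continuous (at p within M) f"
    using * by simp
qed

text \<open>Splitting \<open>A\<close> along one \<open>C p\<close> leaves a rest covered by the
  other sets, and additivity joins the parts. It allows the volumes to be compared inside one chart
  at a time.\<close>

lemma measure_eqI_finite_cover:
  assumes sets: "sets \<mu> = sets \<nu>" and "finite P" and C: "\<And>p. p \<in> P \<Longrightarrow> C p \<in> sets \<nu>"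
    and cover: "space \<nu> \<subseteq> (\<Union>p\<in>P. C p)"
    and eq: "\<And>p A. p \<in> P \<Longrightarrow> A \<in> sets \<nu> \<Longrightarrow> A \<subseteq> C p \<Longrightarrow> emeasure \<mu> A = emeasure \<nu> A"
  shows "\<mu> = \<nu>"
proof (rule measure_eqI[OF sets])
  have "emeasure \<mu> A = emeasure \<nu> A" if "A \<in> sets \<nu>" "A \<subseteq> (\<Union>p\<in>P. C p)" for A
    using \<open>finite P\<close> C eq that
  proof (induction P arbitrary: A rule: finite_induct)
    case (insert p P)
    have A: "A \<inter> C p \<in> sets \<nu>" "A - C p \<in> sets \<nu>"
      using insert.prems by auto
    have "emeasure \<mu> (A \<inter> C p) = emeasure \<nu> (A \<inter> C p)"
      by (rule insert.prems(2)) (use A in auto)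
    moreover have "emeasure \<mu> (A - C p) = emeasure \<nu> (A - C p)"
      by (rule insert.IH) (use A insert.prems in auto)
    moreover have "A = (A \<inter> C p) \<union> (A - C p)"
      by blast
    ultimately show ?case
      using plus_emeasure[of "A \<inter> C p" \<mu> "A - C p"] plus_emeasure[of "A \<inter> C p" \<nu> "A - C p"] A sets
      by (simp add: Int_Diff_disjoint Int_Diff_Un)
  qed simp
  then show "emeasure \<mu> A = emeasure \<nu> A" if "A \<in> sets \<mu>" for A
    using that sets cover sets.sets_into_space[of A \<nu>] by blast
qed

context
  fixes M :: "'a::euclidean_space set" and M' :: "'b::euclidean_space set" and g g' \<xi>
  assumes M: "closed_riemannian_manifold TYPE('n::finite) M g"
    and M': "closed_riemannian_manifold TYPE('n) M' g'"
    and iso: "riemannian_isometry TYPE('n) M g M' g' \<xi>"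
begin

lemma isometry_homeomorphism: "homeomorphism M M' \<xi> (inv_into M \<xi>)"
proof -
  have bij: "bij_betw \<xi> M M'"
    and s: "smooth_on_manifold TYPE('n) M \<xi>" "smooth_on_manifold TYPE('n) M' (inv_into M \<xi>)"
    using iso by (auto simp: riemannian_isometry_def)
  have "continuous_on M \<xi>" "continuous_on M' (inv_into M \<xi>)"
    using s M M' smooth_on_manifold_continuous unfolding closed_riemannian_manifold_def by blast+
  then show ?thesis
    using bij bij_betw_inv_into[OF bij]
    by (auto simp: homeomorphism_def bij_betw_def f_inv_into_f)
qed

text \<open>A vector killed by the derivative of \<open>\<xi> \<circ> \<phi>\<close> has length zero
  with respect to \<open>g\<close>, so the composition remains an immersion; the topological
  conditions hold because \<open>\<xi>\<close> is a homeomorphism.\<close>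

lemma isometry_chart:
  fixes U :: "(real^'n) set"
  assumes \<phi>: "chart M U \<phi>"
  shows "chart M' U (\<xi> \<circ> \<phi>)"
proof -
  have metric: "riemannian_metric TYPE('n) M g" "riemannian_metric TYPE('n) M' g'"
    and sub: "smooth_submanifold TYPE('n) M'"
    using M M' by (auto simp: closed_riemannian_manifold_def)
  have \<xi>_smooth: "smooth_on U (\<xi> \<circ> \<phi>)"
    using iso \<phi> unfolding riemannian_isometry_def smooth_on_manifold_def by blast
  have inj: "inj (frechet_derivative (\<xi> \<circ> \<phi>) (at x))" if x: "x \<in> U" for x
  proof -
    have lin: "linear (frechet_derivative (\<xi> \<circ> \<phi>) (at x))"
      by (rule linear_frechet_derivative[OF smooth_on_differentiable[OF \<xi>_smooth x]])
    have "\<xi> (\<phi> x) \<in> M'"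
      using homeomorphism_image1[OF isometry_homeomorphism] chart_mem[OF \<phi> x] by blast
    then obtain V :: "(real^'n) set" and \<theta> y where \<theta>: "chart M' V \<theta>" and y: "y \<in> V" "\<theta> y = \<xi> (\<phi> x)"
      using sub unfolding smooth_submanifold_def by (metis imageE)
    \<comment> \<open>The metric axioms concern tangent vectors only; the chart
      \<open>\<theta>\<close> at this point makes 0 such a vector.\<close>
    have zero: "g' (\<xi> (\<phi> x)) 0 0 = 0"
      using metric_eq_gram[OF metric(2) \<theta> y(1), of 0 0] linear_0[OF chart_linear_derivative[OF \<theta> y(1)]] y(2)
      by simp
    have "v = 0" if "frechet_derivative (\<xi> \<circ> \<phi>) (at x) v = 0" for v
    proof (rule ccontr)
      assume "v \<noteq> 0"
      have "g (\<phi> x) (frechet_derivative \<phi> (at x) v) (frechet_derivative \<phi> (at x) v) = 0"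
        using iso \<phi> x zero that unfolding riemannian_isometry_def by metis
      then show False
        using gram_pos_def[OF metric(1) \<phi> x \<open>v \<noteq> 0\<close>] metric_eq_gram[OF metric(1) \<phi> x] by simp
    qed
    then show ?thesis
      using linear_injective_0[OF lin] by blast
  qed
  have "openin (top_of_set M') ((\<xi> \<circ> \<phi>) ` U)"
    using homeomorphism_imp_open_map[OF isometry_homeomorphism chart_openin[OF \<phi>]] by (simp add: image_comp)
  moreover obtain \<psi> where \<psi>: "homeomorphism U (\<phi> ` U) \<phi> \<psi>"
    using chart_homeomorphism[OF \<phi>] by blast
  have "homeomorphism (\<phi> ` U) (\<xi> ` \<phi> ` U) \<xi> (inv_into M \<xi>)"
    using chart_image_subset[OF \<phi>] homeomorphism_image1[OF isometry_homeomorphism]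
    by (intro homeomorphism_of_subsets[OF isometry_homeomorphism]) auto
  from homeomorphism_compose[OF \<psi> this]
  have "homeomorphism U ((\<xi> \<circ> \<phi>) ` U) (\<xi> \<circ> \<phi>) (\<psi> \<circ> inv_into M \<xi>)"
    by (simp add: image_comp)
  ultimately show ?thesis
    using chart_open[OF \<phi>] \<xi>_smooth inj unfolding chart_def by blast
qed

lemma isometry_gram:
  fixes U :: "(real^'n) set"
  shows "chart M U \<phi> \<Longrightarrow> x \<in> U \<Longrightarrow> gram g' (\<xi> \<circ> \<phi>) x = gram g \<phi> x"
  using iso unfolding riemannian_isometry_def gram_def partial_deriv_def by simp

text \<open>In the charts \<open>\<phi>\<close> and \<open>\<xi> \<circ> \<phi>\<close> the Gram
  matrices agree, so both Laplacians have the same coordinate expression.\<close>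

lemma has_laplacian_pullback:
  assumes "has_laplacian TYPE('n) M' g' u w"
  shows "has_laplacian TYPE('n) M g (\<lambda>p. u (\<xi> p)) (\<lambda>p. w (\<xi> p))"
  unfolding has_laplacian_def
proof (intro conjI allI impI ballI)
  show "smooth_on_manifold TYPE('n) M (\<lambda>p. u (\<xi> p))"
    unfolding smooth_on_manifold_def
  proof (intro allI impI)
    fix U :: "(real^'n) set" and \<phi> assume "chart M U \<phi>"
    then have "smooth_on U (u \<circ> (\<xi> \<circ> \<phi>))"
      using assms isometry_chart smooth_on_manifold_chart unfolding has_laplacian_def by blast
    then show "smooth_on U ((\<lambda>p. u (\<xi> p)) \<circ> \<phi>)"
      by (simp add: comp_def)
  qed
  fix U :: "(real^'n) set" and \<phi> x assume \<phi>: "chart M U \<phi>" and x: "x \<in> U"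
  have "\<forall>x\<in>U. w ((\<xi> \<circ> \<phi>) x) = laplacian_in_chart g' (\<xi> \<circ> \<phi>) (u \<circ> (\<xi> \<circ> \<phi>)) x"
    using assms isometry_chart[OF \<phi>] unfolding has_laplacian_def by blast
  then have "w (\<xi> (\<phi> x)) = laplacian_in_chart g' (\<xi> \<circ> \<phi>) (u \<circ> (\<xi> \<circ> \<phi>)) x"
    using x by simp
  \<comment> \<open>The Gram matrices agree only on \<open>U\<close>; being open, \<open>U\<close>
    determines the outer partial derivatives.\<close>
  also have "\<dots> = laplacian_in_chart g \<phi> (u \<circ> (\<xi> \<circ> \<phi>)) x"
    unfolding laplacian_in_chart_def isometry_gram[OF \<phi> x]
    by (intro arg_cong2[where f = "(*)"] refl sum.cong partial_deriv_cong[OF chart_open[OF \<phi>] x])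
      (simp_all add: isometry_gram[OF \<phi>])
  finally show "w (\<xi> (\<phi> x)) = laplacian_in_chart g \<phi> ((\<lambda>p. u (\<xi> p)) \<circ> \<phi>) x"
    by (simp add: comp_def)
qed

text \<open>For a set inside one chart image both measures are the same coordinate integral;
  compactness of \<open>M'\<close> reduces the general case to finitely many such pieces.\<close>

lemma isometry_measure_isomorphism:
  assumes vol: "riemannian_volume TYPE('n) M g \<mu>" and vol': "riemannian_volume TYPE('n) M' g' \<mu>'"
  shows "measure_isomorphism \<mu> \<mu>' \<xi> (inv_into M \<xi>)"
proof
  note hom = isometry_homeomorphism
  have sets: "sets \<mu> = sets (restrict_space borel M)" "sets \<mu>' = sets (restrict_space borel M')"
    and space: "space \<mu> = M" "space \<mu>' = M'"
    using vol vol' riemannian_volume_space[OF vol] riemannian_volume_space[OF vol']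
    by (auto simp: riemannian_volume_def)
  show meas: "\<xi> \<in> measurable \<mu> \<mu>'"
    unfolding measurable_cong_sets[OF sets]
    using homeomorphism_cont1[OF hom] homeomorphism_image1[OF hom]
    by (intro measurable_restrict_space2 borel_measurable_continuous_on_restrict) (auto simp: space_restrict_space)
  show "inv_into M \<xi> \<in> measurable \<mu>' \<mu>"
    unfolding measurable_cong_sets[OF sets(2,1)]
    using homeomorphism_cont2[OF hom] homeomorphism_image2[OF hom]
    by (intro measurable_restrict_space2 borel_measurable_continuous_on_restrict) (auto simp: space_restrict_space)
  show "inv_into M \<xi> (\<xi> x) = x" if "x \<in> space \<mu>" for x
    using homeomorphism_apply1[OF hom] that space by simp
  show "\<xi> (inv_into M \<xi> y) = y" if "y \<in> space \<mu>'" for y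
    using homeomorphism_apply2[OF hom] that space by simp
  have compact: "compact M'" and sub: "smooth_submanifold TYPE('n) M"
    using M M' by (auto simp: closed_riemannian_manifold_def)
  have "\<exists>(U :: (real^'n) set) \<phi> T. chart M U \<phi> \<and> open T \<and> q \<in> T \<and> (\<xi> \<circ> \<phi>) ` U = M' \<inter> T" if q: "q \<in> M'" for q
  proof -
    obtain p where p: "p \<in> M" "q = \<xi> p"
      using homeomorphism_image1[OF hom] q by blast
    then obtain U :: "(real^'n) set" and \<phi> where \<phi>: "chart M U \<phi>" and "p \<in> \<phi> ` U"
      using sub unfolding smooth_submanifold_def by blast
    moreover obtain T where T: "open T" "(\<xi> \<circ> \<phi>) ` U = M' \<inter> T"
      using chart_openin[OF isometry_chart[OF \<phi>]] by (auto simp: openin_open)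
    ultimately have "q \<in> M' \<inter> T"
      unfolding T(2)[symmetric] using p(2) by auto
    then show ?thesis
      using \<phi> T by blast
  qed
  then obtain U :: "'b \<Rightarrow> (real^'n) set" and \<phi> T where \<phi>: "\<And>q. q \<in> M' \<Longrightarrow> chart M (U q) (\<phi> q)"
    and T: "\<And>q. q \<in> M' \<Longrightarrow> open (T q)" "\<And>q. q \<in> M' \<Longrightarrow> q \<in> T q"
      "\<And>q. q \<in> M' \<Longrightarrow> (\<xi> \<circ> \<phi> q) ` U q = M' \<inter> T q"
    by metis
  obtain P where P: "P \<subseteq> M'" "finite P" "M' \<subseteq> (\<Union>q\<in>P. T q)"
  proof (rule compactE_image[OF compact, of M' T])
    show "open (T q)" if "q \<in> M'" for q
      using T(1)[OF that] .
    show "M' \<subseteq> (\<Union>q\<in>M'. T q)"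
      using T(2) by blast
  qed
  show "distr \<mu> \<mu>' \<xi> = \<mu>'"
  proof (rule measure_eqI_finite_cover[where P = P and C = "\<lambda>q. M' \<inter> T q"])
    show "sets (distr \<mu> \<mu>' \<xi>) = sets \<mu>'" "finite P"
      using P(2) by simp_all
    show "M' \<inter> T q \<in> sets \<mu>'" if "q \<in> P" for q
    proof -
      have "T q \<in> sets borel"
        by (rule borel_open[OF T(1)]) (use P(1) that in blast)
      then show ?thesis
        unfolding sets(2) sets_restrict_space by (rule imageI)
    qed
    show "space \<mu>' \<subseteq> (\<Union>q\<in>P. M' \<inter> T q)"
      using P(3) space by auto
    fix q A assume q: "q \<in> P" and A: "A \<in> sets \<mu>'" "A \<subseteq> M' \<inter> T q"
    define B where "B = \<xi> -` A \<inter> M"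
    have \<phi>q: "chart M (U q) (\<phi> q)" and Tq: "(\<xi> \<circ> \<phi> q) ` U q = M' \<inter> T q"
      using \<phi> T(3) P(1) q by auto
    have "B \<in> sets \<mu>"
      unfolding B_def using measurable_sets[OF meas A(1)] space by simp
    moreover have "B \<subseteq> \<phi> q ` U q"
    proof
      fix p assume p: "p \<in> B"
      then have "\<xi> p \<in> (\<xi> \<circ> \<phi> q) ` U q"
        unfolding Tq using A(2) by (auto simp: B_def)
      then obtain x where x: "x \<in> U q" "\<xi> p = \<xi> (\<phi> q x)"
        by auto
      then have "p = \<phi> q x"
        using homeomorphism_apply1[OF hom] p chart_mem[OF \<phi>q x(1)] by (metis B_def IntD2)
      then show "p \<in> \<phi> q ` U q"
        using x by blast
    qed
    ultimately have "emeasure \<mu> B = (\<integral>\<^sup>+x\<in>U q \<inter> \<phi> q -` B. ennreal (sqrt (det (gram g (\<phi> q) x))) \<partial>lborel)"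
      using vol \<phi>q unfolding riemannian_volume_def by blast
    also have "\<dots> = (\<integral>\<^sup>+x\<in>U q \<inter> (\<xi> \<circ> \<phi> q) -` A. ennreal (sqrt (det (gram g' (\<xi> \<circ> \<phi> q) x))) \<partial>lborel)"
      by (intro nn_integral_cong)
        (auto simp: B_def isometry_gram[OF \<phi>q] chart_mem[OF \<phi>q] split: split_indicator)
    also have "\<dots> = emeasure \<mu>' A"
    proof -
      have "A \<subseteq> (\<xi> \<circ> \<phi> q) ` U q"
        using A(2) Tq by simp
      then show ?thesis
        using vol' isometry_chart[OF \<phi>q] A(1) unfolding riemannian_volume_def by simp
    qed
    finally show "emeasure (distr \<mu> \<mu>' \<xi>) A = emeasure \<mu>' A"
      using A(1) meas space by (simp add: emeasure_distr B_def)
  qed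
qed

end

section \<open>Scattering on isometric manifolds\<close>

lemma laplace_eigenvalue_nonneg:
  assumes "closed_riemannian_manifold TYPE('n::finite) M g" "riemannian_volume TYPE('n) M g \<mu>"
    and "laplace_eigenbasis TYPE('n) M g \<mu> lam e"
  shows "lam k \<ge> 0"
  using eigenvalue_nonneg[OF assms(1,2), of "e k" "lam k"] assms(3)
  by (simp add: laplace_eigenbasis_def orthonormal_basis_def)

theorem theorem11:
  fixes M :: "'a::euclidean_space set" and M' :: "'b::euclidean_space set"
    and g :: "'a \<Rightarrow> 'a \<Rightarrow> 'a \<Rightarrow> real" and g' :: "'b \<Rightarrow> 'b \<Rightarrow> 'b \<Rightarrow> real"
    and \<mu> :: "'a measure" and \<mu>' :: "'b measure"
    and lam lam' :: "nat \<Rightarrow> real"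
    and e :: "nat \<Rightarrow> 'a \<Rightarrow> real" and e' :: "nat \<Rightarrow> 'b \<Rightarrow> real"
    and G :: "real \<Rightarrow> real" and \<xi> :: "'a \<Rightarrow> 'b" and f :: "'a \<Rightarrow> real" and m :: nat
  assumes "closed_riemannian_manifold TYPE('n::finite) M g"
    and "riemannian_volume TYPE('n) M g \<mu>"
    and "laplace_eigenbasis TYPE('n) M g \<mu> lam e"
    and "closed_riemannian_manifold TYPE('n) M' g'"
    and "riemannian_volume TYPE('n) M' g' \<mu>'"
    and "laplace_eigenbasis TYPE('n) M' g' \<mu>' lam' e'"
    and "riemannian_isometry TYPE('n) M g M' g' \<xi>"
    and "f \<in> L2 \<mu>"
    and "\<And>x. x \<ge> 0 \<Longrightarrow> G x \<ge> 0"
    and "antimono_on {0..} G"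
    and "continuous_on {0..} G"
    and "G 0 > 0"
    and "(G \<longlongrightarrow> 0) at_top"
    and "m \<ge> 1"
  shows "\<forall>js :: int list. length js = m \<longrightarrow>
    nonwindowed_scattering G \<mu>' lam' e' (transport M \<xi> f) js = nonwindowed_scattering G \<mu> lam e f js"
proof (intro allI impI)
  fix js :: "int list"
  interpret measure_isomorphism \<mu> \<mu>' \<xi> "inv_into M \<xi>"
    using assms(1,4,7,2,5) by (rule isometry_measure_isomorphism)
  have e: "orthonormal_basis \<mu> e" "orthonormal_basis \<mu>' e'"
    and eL: "\<And>k. e k \<in> L2 \<mu>" "\<And>k. e' k \<in> L2 \<mu>'"
    and lap: "\<And>k. has_laplacian TYPE('n) M g (e k) (\<lambda>p. - (lam k * e k p))"
      "\<And>k. has_laplacian TYPE('n) M' g' (e' k) (\<lambda>p. - (lam' k * e' k p))"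
    using assms(3,6) by (auto simp: laplace_eigenbasis_def orthonormal_basis_def)
  \<comment> \<open>The pullback of \<open>e' l\<close> is an eigenfunction on \<open>M\<close> for
    \<open>lam' l\<close>, so it can be compared with \<open>e k\<close> on one manifold.\<close>
  have orth: "L2_inner \<mu> (e k) (\<lambda>p. e' l (\<xi> p)) = 0" if "lam k \<noteq> lam' l" for k l
    using eigenfunctions_orthogonal[OF assms(1,2) lap(1) eL(1)
        has_laplacian_pullback[OF assms(1,4,7) lap(2)] L2_pullback[OF eL(2)] that] .
  show "nonwindowed_scattering G \<mu>' lam' e' (transport M \<xi> f) js = nonwindowed_scattering G \<mu> lam e f js"
    unfolding transport_def
    using assms(9,10) laplace_eigenvalue_nonneg[OF assms(1,2,3)] laplace_eigenvalue_nonneg[OF assms(4,5,6)]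
      e orth assms(8)
    by (rule nonwindowed_scattering_pushforward)
qed

end
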